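(* Let $M$ be a manifold. The $2$-form $\omega_2\in\Omega^2(\mathfrak{C}_2(M))$ is the simplicial coboundary of $\omega_1\in\Omega^2(\mathfrak{C}_1(M))$, i.e. $\omega_2=\delta\omega_1$.
   Context: Fix integers $p\ge q\ge 0$. A map $\phi$ into a vector bundle $\pi:E\to M$ is $C^{p,q}$ if $\phi$ is $C^q$ and $\pi\circ\phi$ is $C^p$. $\Delta^n\subset\mathbb{R}^n$ is the standard $n$-simplex with vertices ordered $0,\dots,n$ ($\Delta^1=[0,1]$, and $\partial\Delta^2$ has the induced boundary orientation). $\mathfrak{C}_n(M)$ is the Banach manifold of $C^{p,q}$ bundle maps $T\Delta^n\to T^*M$; these form a simplicial manifold with faces $d_i$ obtained by precomposition with the tangent maps of the cofaces of $\Delta^\bullet$. A tangent vector at $\varphi\in\mathfrak{C}_n(M)$ is a $C^{p,q}$ lift $X:T\Delta^n\to T(T^*M)$ of $\varphi$ that is linear over $TM$, with $C^p$ base map $\Delta^n\to TM$. Let $\lambda_{\mathrm{can}}$ be the tautological $1$-form on $T^*M$ and $\omega_{\mathrm{can}}=-d\lambda_{\mathrm{can}}$. For $X,Y\in T_\varphi\mathfrak{C}_n(M)$ let $\eta^n_{X,Y}(v)=\omega_{\mathrm{can}}(X(v),Y(v))$ for $v\in T\Delta^n$; this is linear in $v$, hence a $1$-form on $\Delta^n$. Define $\omega_1(X,Y)=\int_{\Delta^1}\eta^1_{X,Y}$ and $\omega_2(X,Y)=\int_{\Delta^2}d\eta^2_{X,Y}=\int_{\partial\Delta^2}\eta^2_{X,Y}$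 (the boundary integral being the definition when differentiability is too low). The simplicial coboundary of a form $\alpha$ on $X_n$, for a simplicial manifold $X_\bullet$, is $\delta\alpha=\sum_{i=0}^{n+1}(-1)^id_i^*\alpha$. *)

theory Defs
  imports "HOL-Analysis.Analysis"
begin

section \<open>Differentiability classes\<close>

text \<open>
  The sets \<open>S\<close> below are relatively open subsets of finite-dimensional closed convex sets with
  nonempty interior (or open sets), so derivatives within \<open>S\<close> are unique. As the domain is
  finite-dimensional, being \<open>C\<^sup>k\<close> may be tested on directional derivatives.
\<close>

primrec Ck_on :: "nat \<Rightarrow> ('a::real_normed_vector \<Rightarrow> 'b::real_normed_vector) \<Rightarrow> 'a set \<Rightarrow> bool" where
  "Ck_on 0 f S \<longleftrightarrow> continuous_on S f"
| "Ck_on (Suc k) f S \<longleftrightarrow>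
     (\<exists>f'. (\<forall>x\<in>S. (f has_derivative f' x) (at x within S)) \<and> (\<forall>v. Ck_on k (\<lambda>x. f' x v) S))"


section \<open>Manifolds\<close>

text \<open>A chart is a domain together with a coordinate map, only the values on the domain matter.\<close>

type_synonym ('a, 'e) chart = "'a set \<times> ('a \<Rightarrow> 'e)"

definition transition :: "('a, 'e) chart \<Rightarrow> ('a, 'e) chart \<Rightarrow> 'e \<Rightarrow> 'e" where
  "transition \<kappa> \<kappa>' = snd \<kappa>' \<circ> inv_into (fst \<kappa>) (snd \<kappa>)"

definition smooth_atlas :: "('a, 'e::real_normed_vector) chart set \<Rightarrow> bool" where
  "smooth_atlas A \<longleftrightarrow>
     (\<forall>\<kappa>\<in>A. inj_on (snd \<kappa>) (fst \<kappa>) \<and> open (snd \<kappa> ` fst \<kappa>)) \<and>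
     (\<forall>\<kappa>\<in>A. \<forall>\<kappa>'\<in>A. open (snd \<kappa> ` (fst \<kappa> \<inter> fst \<kappa>')) \<and>
        (\<forall>k. Ck_on k (transition \<kappa> \<kappa>') (snd \<kappa> ` (fst \<kappa> \<inter> fst \<kappa>'))))"

definition points :: "('a, 'e) chart set \<Rightarrow> 'a set" where
  "points A = (\<Union>\<kappa>\<in>A. fst \<kappa>)"

definition charts_at :: "('a, 'e) chart set \<Rightarrow> 'a \<Rightarrow> ('a, 'e) chart set" where
  "charts_at A p = {\<kappa>\<in>A. p \<in> fst \<kappa>}"

definition atlas_topology :: "('a, 'e::real_normed_vector) chart set \<Rightarrow> 'a topology" where
  "atlas_topology A =
     topology (\<lambda>W. W \<subseteq> points A \<and> (\<forall>\<kappa>\<in>A. open (snd \<kappa> ` (fst \<kappa> \<inter> W))))"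

lemma openin_atlas_topology:
  assumes "smooth_atlas A"
  shows "openin (atlas_topology A) W \<longleftrightarrow>
    W \<subseteq> points A \<and> (\<forall>\<kappa>\<in>A. open (snd \<kappa> ` (fst \<kappa> \<inter> W)))"
proof -
  let ?P = "\<lambda>W. W \<subseteq> points A \<and> (\<forall>\<kappa>\<in>A. open (snd \<kappa> ` (fst \<kappa> \<inter> W)))"
  have "?P (V \<inter> W)" if "?P V" "?P W" for V W
  proof -
    have "snd \<kappa> ` (fst \<kappa> \<inter> (V \<inter> W)) = snd \<kappa> ` (fst \<kappa> \<inter> V) \<inter> snd \<kappa> ` (fst \<kappa> \<inter> W)"
      if "\<kappa> \<in> A" for \<kappa>
      using assms that unfolding smooth_atlas_def inj_on_def by blast
    with that show ?thesis by auto
  qed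
  moreover have "?P (\<Union>\<W>)" if "\<forall>W\<in>\<W>. ?P W" for \<W>
  proof -
    have "snd \<kappa> ` (fst \<kappa> \<inter> \<Union>\<W>) = (\<Union>W\<in>\<W>. snd \<kappa> ` (fst \<kappa> \<inter> W))" for \<kappa> :: "('a, 'b) chart"
      by blast
    with that show ?thesis by (auto intro!: open_UN)
  qed
  ultimately have "istopology ?P"
    unfolding istopology_def by blast
  then show ?thesis
    by (simp add: atlas_topology_def topology_inverse')
qed

text \<open>
  A smooth manifold, given by an atlas. The model space is a finite-dimensional normed space
  and not of class \<open>euclidean_space\<close>, as that class excludes dimension 0.
\<close>

definition smooth_manifold :: "('a, 'e::real_normed_vector) chart set \<Rightarrow> bool" where
  "smooth_manifold A \<longleftrightarrow> (\<exists>B::'e set. finite B \<and> span B = UNIV) \<and> smooth_atlas A \<and>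
     Hausdorff_space (atlas_topology A) \<and> second_countable (atlas_topology A)"

definition Ck_map ::
  "nat \<Rightarrow> ('d::real_normed_vector \<Rightarrow> 'a) \<Rightarrow> 'd set \<Rightarrow> ('a, 'e::real_normed_vector) chart set \<Rightarrow> bool"
where
  "Ck_map k f S A \<longleftrightarrow> f ` S \<subseteq> points A \<and>
     (\<forall>x\<in>S. \<forall>\<kappa>\<in>charts_at A (f x). \<exists>W. open W \<and> x \<in> W \<and>
        f ` (S \<inter> W) \<subseteq> fst \<kappa> \<and> Ck_on k (snd \<kappa> \<circ> f) (S \<inter> W))"

text \<open>\<open>C\<^sup>p\<^sup>,\<^sup>q\<close> maps into a vector bundle with projection \<open>\<pi>\<close>, total space \<open>E\<close> and base \<open>A\<close>.\<close>

definition Cpq_map ::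
  "nat \<Rightarrow> nat \<Rightarrow> ('b, 'f::real_normed_vector) chart set \<Rightarrow> ('b \<Rightarrow> 'a) \<Rightarrow>
    ('a, 'e::real_normed_vector) chart set \<Rightarrow> ('d::real_normed_vector \<Rightarrow> 'b) \<Rightarrow> 'd set \<Rightarrow> bool"
where
  "Cpq_map p q E \<pi> A \<phi> S \<longleftrightarrow> Ck_map q \<phi> S E \<and> Ck_map p (\<pi> \<circ> \<phi>) S A"


section \<open>Tangent and cotangent bundles\<close>

text \<open>
  A tangent vector at \<open>x\<close> is the family of its coordinate vectors in all charts at \<open>x\<close>
  (and 0 at the other charts).
\<close>

type_synonym ('a, 'e) tvec = "('a, 'e) chart \<Rightarrow> 'e"

definition tangent_space ::
  "('a, 'e::real_normed_vector) chart set \<Rightarrow> 'a \<Rightarrow> ('a, 'e) tvec set"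
where
  "tangent_space A x = {v. (\<forall>\<kappa>. \<kappa> \<notin> charts_at A x \<longrightarrow> v \<kappa> = 0) \<and>
     (\<forall>\<kappa>\<in>charts_at A x. \<forall>\<kappa>'\<in>charts_at A x.
        v \<kappa>' = frechet_derivative (transition \<kappa> \<kappa>') (at (snd \<kappa> x)) (v \<kappa>))}"

text \<open>The tangent vector at \<open>x\<close> whose coordinate vector in the chart \<open>\<kappa>\<close> is \<open>w\<close>.\<close>

definition tangent_of ::
  "('a, 'e::real_normed_vector) chart set \<Rightarrow> ('a, 'e) chart \<Rightarrow> 'a \<Rightarrow> 'e \<Rightarrow> ('a, 'e) tvec"
where
  "tangent_of A \<kappa> x w =
     (\<lambda>\<kappa>'. if \<kappa>' \<in> charts_at A x
           then frechet_derivative (transition \<kappa> \<kappa>') (at (snd \<kappa> x)) w else 0)"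

definition tangent_chart ::
  "('a, 'e::real_normed_vector) chart set \<Rightarrow> ('a, 'e) chart \<Rightarrow> ('a \<times> ('a, 'e) tvec, 'e \<times> 'e) chart"
where
  "tangent_chart A \<kappa> = (Sigma (fst \<kappa>) (tangent_space A), \<lambda>(x, v). (snd \<kappa> x, v \<kappa>))"

definition tangent_bundle ::
  "('a, 'e::real_normed_vector) chart set \<Rightarrow> ('a \<times> ('a, 'e) tvec, 'e \<times> 'e) chart set"
where
  "tangent_bundle A = tangent_chart A ` A"

definition tangent_map ::
  "('a, 'e::real_normed_vector) chart set \<Rightarrow> ('b, 'f::real_normed_vector) chart set \<Rightarrow>
    ('a \<Rightarrow> 'b) \<Rightarrow> 'a \<times> ('a, 'e) tvec \<Rightarrow> 'b \<times> ('b, 'f) tvec"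
where
  "tangent_map A B f = (\<lambda>(x, v).
     let \<kappa> = (SOME \<kappa>. \<kappa> \<in> charts_at A x)
     in (f x, \<lambda>\<kappa>'. if \<kappa>' \<in> charts_at B (f x)
          then frechet_derivative (snd \<kappa>' \<circ> f \<circ> inv_into (fst \<kappa>) (snd \<kappa>)) (at (snd \<kappa> x)) (v \<kappa>)
          else 0))"

text \<open>Covectors are linear functionals on the tangent space, extended by 0.\<close>

type_synonym ('a, 'e) covec = "('a, 'e) tvec \<Rightarrow> real"

definition cotangent_space ::
  "('a, 'e::real_normed_vector) chart set \<Rightarrow> 'a \<Rightarrow> ('a, 'e) covec set"
where
  "cotangent_space A x = {\<alpha>. (\<forall>v. v \<notin> tangent_space A x \<longrightarrow> \<alpha> v = 0) \<and>
     (\<forall>v\<in>tangent_space A x. \<forall>w\<in>tangent_space A x. \<alpha> (\<lambda>\<kappa>. v \<kappa> + w \<kappa>) = \<alpha> v + \<alpha> w) \<and>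
     (\<forall>v\<in>tangent_space A x. \<forall>r. \<alpha> (\<lambda>\<kappa>. r *\<^sub>R v \<kappa>) = r * \<alpha> v)}"

text \<open>
  \<open>Blinfun\<close> is harmless here: the model space is finite-dimensional, so all linear functionals
  on it are bounded.
\<close>

definition cotangent_chart ::
  "('a, 'e::real_normed_vector) chart set \<Rightarrow> ('a, 'e) chart \<Rightarrow>
    ('a \<times> ('a, 'e) covec, 'e \<times> ('e \<Rightarrow>\<^sub>L real)) chart"
where
  "cotangent_chart A \<kappa> =
     (Sigma (fst \<kappa>) (cotangent_space A),
      \<lambda>(x, \<alpha>). (snd \<kappa> x, Blinfun (\<lambda>w. \<alpha> (tangent_of A \<kappa> x w))))"

definition cotangent_bundle ::
  "('a, 'e::real_normed_vector) chart set \<Rightarrow>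
    ('a \<times> ('a, 'e) covec, 'e \<times> ('e \<Rightarrow>\<^sub>L real)) chart set"
where
  "cotangent_bundle A = cotangent_chart A ` A"

type_synonym ('a, 'e) cot = "'a \<times> ('a, 'e) covec"

type_synonym ('a, 'e) tcot =
  "('a, 'e) cot \<times> (('a, 'e) cot, 'e \<times> ('e \<Rightarrow>\<^sub>L real)) tvec"

abbreviation T_proj ::
  "('a, 'e::real_normed_vector) chart set \<Rightarrow> ('a, 'e) tcot \<Rightarrow> 'a \<times> ('a, 'e) tvec"
where
  "T_proj M \<equiv> tangent_map (cotangent_bundle M) M fst"

text \<open>
  The chart of \<open>T(T\<^sup>*M)\<close> induced by a chart \<open>\<kappa>\<close> of \<open>M\<close> has coordinates \<open>((x, \<xi>), (x', \<xi>'))\<close>, where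
  \<open>(x, x')\<close> are the coordinates of the image in \<open>TM\<close>. For fixed \<open>(x, x')\<close>, changes of charts are
  linear in \<open>(\<xi>, \<xi>')\<close>; these are the fibre coordinates of the vector bundle \<open>T(T\<^sup>*M) \<rightarrow> TM\<close>.
\<close>

definition fibre_coords ::
  "('a, 'e::real_normed_vector) chart set \<Rightarrow> ('a, 'e) chart \<Rightarrow> ('a, 'e) tcot \<Rightarrow>
    ('e \<Rightarrow>\<^sub>L real) \<times> ('e \<Rightarrow>\<^sub>L real)"
where
  "fibre_coords M \<kappa> = (\<lambda>(z, V).
     (snd (snd (cotangent_chart M \<kappa>) z), snd (V (cotangent_chart M \<kappa>))))"


section \<open>The canonical forms on the cotangent bundle\<close>

definition lambda_can ::
  "('a, 'e::real_normed_vector) chart set \<Rightarrow> ('a, 'e) cot \<Rightarrow>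
    (('a, 'e) cot, 'e \<times> ('e \<Rightarrow>\<^sub>L real)) tvec \<Rightarrow> real"
where
  "lambda_can M z V = snd z (snd (T_proj M (z, V)))"

text \<open>
  The exterior derivative of a 1-form, computed in a chart at the given point (the result does
  not depend on the chart): \<open>d\<theta>(V, W) = V(\<theta>(W)) - W(\<theta>(V))\<close> for \<open>V\<close>, \<open>W\<close> extended to vector fields
  with constant coordinates.
\<close>

definition ext_deriv ::
  "('a, 'e::real_normed_vector) chart set \<Rightarrow> ('a \<Rightarrow> ('a, 'e) tvec \<Rightarrow> real) \<Rightarrow>
    'a \<Rightarrow> ('a, 'e) tvec \<Rightarrow> ('a, 'e) tvec \<Rightarrow> real"
where
  "ext_deriv A \<theta> z V W =
     (let \<kappa> = (SOME \<kappa>. \<kappa> \<in> charts_at A z);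
          l = (\<lambda>w y. let z' = inv_into (fst \<kappa>) (snd \<kappa>) y in \<theta> z' (tangent_of A \<kappa> z' w))
      in frechet_derivative (l (W \<kappa>)) (at (snd \<kappa> z)) (V \<kappa>)
       - frechet_derivative (l (V \<kappa>)) (at (snd \<kappa> z)) (W \<kappa>))"

definition omega_can ::
  "('a, 'e::real_normed_vector) chart set \<Rightarrow> ('a, 'e) cot \<Rightarrow>
    (('a, 'e) cot, 'e \<times> ('e \<Rightarrow>\<^sub>L real)) tvec \<Rightarrow>
    (('a, 'e) cot, 'e \<times> ('e \<Rightarrow>\<^sub>L real)) tvec \<Rightarrow> real"
where
  "omega_can M z V W = - ext_deriv (cotangent_bundle M) (lambda_can M) z V W"


section \<open>Bundle maps on simplices\<close>

text \<open>
  \<open>TS = S \<times> UNIV\<close> for a simplex \<open>S\<close> of full dimension. Maps on \<open>TS\<close> are extensional (elements of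
  \<open>\<rightarrow>\<^sub>E\<close>), so that they are determined by their values on \<open>TS\<close>.
\<close>

definition bundle_maps ::
  "nat \<Rightarrow> nat \<Rightarrow> ('a, 'e::real_normed_vector) chart set \<Rightarrow> 'd::euclidean_space set \<Rightarrow>
    ('d \<times> 'd \<Rightarrow> ('a, 'e) cot) set"
where
  "bundle_maps p q M S = {\<phi> \<in> (S \<times> UNIV) \<rightarrow>\<^sub>E points (cotangent_bundle M).
     (\<exists>f. \<forall>x\<in>S. \<forall>v. fst (\<phi> (x, v)) = f x) \<and>
     (\<forall>x\<in>S. \<forall>u. linear (\<lambda>v. snd (\<phi> (x, v)) u)) \<and>
     Cpq_map p q (cotangent_bundle M) fst M \<phi> (S \<times> UNIV)}"

text \<open>
  Tangent vectors at \<open>\<phi>\<close>. The third condition says that \<open>X\<close> covers a map \<open>g\<close> from \<open>S\<close> to \<open>TM\<close>; it is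
  \<open>C\<^sup>p\<close> by the last one.
\<close>

definition tangent_lifts ::
  "nat \<Rightarrow> nat \<Rightarrow> ('a, 'e::real_normed_vector) chart set \<Rightarrow> 'd::euclidean_space set \<Rightarrow>
    ('d \<times> 'd \<Rightarrow> ('a, 'e) cot) \<Rightarrow> ('d \<times> 'd \<Rightarrow> ('a, 'e) tcot) set"
where
  "tangent_lifts p q M S \<phi> = {X \<in> (S \<times> UNIV) \<rightarrow>\<^sub>E points (tangent_bundle (cotangent_bundle M)).
     (\<forall>v\<in>S \<times> UNIV. fst (X v) = \<phi> v) \<and>
     (\<exists>g. \<forall>x\<in>S. \<forall>v. T_proj M (X (x, v)) = g x) \<and>
     (\<forall>x\<in>S. \<forall>\<kappa>\<in>charts_at M (fst (\<phi> (x, 0))). linear (\<lambda>v. fibre_coords M \<kappa> (X (x, v)))) \<and>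
     Cpq_map p q (tangent_bundle (cotangent_bundle M)) (T_proj M) (tangent_bundle M) X (S \<times> UNIV)}"

abbreviation simplex1 :: "real set" where
  "simplex1 \<equiv> {0..1}"

definition vertex2 :: "nat \<Rightarrow> real \<times> real" where
  "vertex2 k = (if k = 0 then (0, 0) else if k = 1 then (1, 0) else (0, 1))"

definition simplex2 :: "(real \<times> real) set" where
  "simplex2 = convex hull (vertex2 ` {0..2})"

text \<open>The affine map sending the vertices 0, 1 in order to the vertices other than \<open>i\<close>.\<close>

definition coface :: "nat \<Rightarrow> real \<Rightarrow> real \<times> real" where
  "coface i t =
     (let s = (\<lambda>j. if j < i then j else j + 1) in (1 - t) *\<^sub>R vertex2 (s 0) + t *\<^sub>R vertex2 (s 1))"

definition tangent_coface :: "nat \<Rightarrow> real \<times> real \<Rightarrow> (real \<times> real) \<times> (real \<times> real)" where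
  "tangent_coface i = (\<lambda>(t, s). (coface i t, frechet_derivative (coface i) (at t) s))"

text \<open>
  Precomposition with the tangent map of the coface. With the codomain \<open>T\<^sup>*M\<close> this is the face
  map \<open>d\<^sub>i\<close> on bundle maps; with the codomain \<open>T(T\<^sup>*M)\<close> it is the tangent map of \<open>d\<^sub>i\<close>, as tangent
  vectors are given by their values at the points of the tangent bundle of the simplex.
\<close>

definition face :: "nat \<Rightarrow> ((real \<times> real) \<times> (real \<times> real) \<Rightarrow> 'c) \<Rightarrow> real \<times> real \<Rightarrow> 'c" where
  "face i \<phi> = restrict (\<phi> \<circ> tangent_coface i) (simplex1 \<times> UNIV)"


section \<open>Two-forms and the simplicial coboundary\<close>

type_synonym ('x, 't) two_form = "'x \<Rightarrow> 't \<Rightarrow> 't \<Rightarrow> real"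

definition pullback :: "('y \<Rightarrow> 'x) \<Rightarrow> ('u \<Rightarrow> 't) \<Rightarrow> ('x, 't) two_form \<Rightarrow> ('y, 'u) two_form" where
  "pullback f Tf \<alpha> = (\<lambda>y X Y. \<alpha> (f y) (Tf X) (Tf Y))"

text \<open>Coboundary of a form on the \<open>n\<close>-th level; \<open>d\<close> are the face maps from level \<open>n + 1\<close>.\<close>

definition simplicial_coboundary ::
  "nat \<Rightarrow> (nat \<Rightarrow> 'y \<Rightarrow> 'x) \<Rightarrow> (nat \<Rightarrow> 'u \<Rightarrow> 't) \<Rightarrow> ('x, 't) two_form \<Rightarrow> ('y, 'u) two_form"
where
  "simplicial_coboundary n d Td \<alpha> =
     (\<lambda>y X Y. \<Sum>i = 0..n + 1. (-1) ^ i * pullback (d i) (Td i) \<alpha> y X Y)"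

text \<open>\<open>X v\<close> and \<open>Y v\<close> have the same base point \<open>fst (X v)\<close> for \<open>X\<close>, \<open>Y\<close> tangent at the same \<open>\<phi>\<close>.\<close>

definition eta ::
  "('a, 'e::real_normed_vector) chart set \<Rightarrow>
    ('v \<Rightarrow> ('a, 'e) tcot) \<Rightarrow> ('v \<Rightarrow> ('a, 'e) tcot) \<Rightarrow> 'v \<Rightarrow> real"
where
  "eta M X Y v = omega_can M (fst (X v)) (snd (X v)) (snd (Y v))"

definition omega1 ::
  "('a, 'e::real_normed_vector) chart set \<Rightarrow>
    (real \<times> real \<Rightarrow> ('a, 'e) cot, real \<times> real \<Rightarrow> ('a, 'e) tcot) two_form"
where
  "omega1 M \<phi> X Y = integral simplex1 (\<lambda>t. eta M X Y (t, 1))"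

definition segment_integral :: "('d::real_normed_vector \<times> 'd \<Rightarrow> real) \<Rightarrow> 'd \<Rightarrow> 'd \<Rightarrow> real" where
  "segment_integral \<theta> a b = integral {0..1} (\<lambda>t. \<theta> (linepath a b t, b - a))"

text \<open>The boundary is traversed counterclockwise.\<close>

definition boundary_integral2 :: "((real \<times> real) \<times> (real \<times> real) \<Rightarrow> real) \<Rightarrow> real" where
  "boundary_integral2 \<theta> =
     segment_integral \<theta> (vertex2 0) (vertex2 1) + segment_integral \<theta> (vertex2 1) (vertex2 2)
     + segment_integral \<theta> (vertex2 2) (vertex2 0)"

text \<open>For \<open>\<theta> = a ds + b dt\<close>, this is the integral of \<open>d\<theta> = (b\<^sub>s - a\<^sub>t) ds dt\<close>.\<close>

definition integral_d2 :: "((real \<times> real) \<times> (real \<times> real) \<Rightarrow> real) \<Rightarrow> real" where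
  "integral_d2 \<theta> = integral simplex2 (\<lambda>x.
     frechet_derivative (\<lambda>y. \<theta> (y, (0, 1))) (at x within simplex2) (1, 0)
     - frechet_derivative (\<lambda>y. \<theta> (y, (1, 0))) (at x within simplex2) (0, 1))"

text \<open>
  \<open>eta\<close> is of class \<open>C\<^sup>q\<close>, so its exterior derivative is available for \<open>q \<ge> 1\<close>; for \<open>q = 0\<close> the
  boundary integral is the definition.
\<close>

definition omega2 ::
  "nat \<Rightarrow> ('a, 'e::real_normed_vector) chart set \<Rightarrow>
    ((real \<times> real) \<times> (real \<times> real) \<Rightarrow> ('a, 'e) cot,
     (real \<times> real) \<times> (real \<times> real) \<Rightarrow> ('a, 'e) tcot) two_form"
where
  "omega2 q M \<phi> X Y =
     (if 1 \<le> q then integral_d2 (eta M X Y) else boundary_integral2 (eta M X Y))"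

end

theory Submission
  imports Defs
begin

text \<open>
  In the coordinates \<open>(x, \<xi>)\<close> of a cotangent chart the tautological form is \<open>\<xi> dx\<close>, so
  \<open>omega_can\<close> is the constant form \<open>dx \<and> d\<xi>\<close> in every such chart. A tangent lift \<open>X\<close> has
  coordinates \<open>(x', \<xi>')\<close> in which \<open>x'\<close> depends only on the base point and \<open>\<xi>'\<close> is linear in
  the tangent vector of the simplex; hence \<open>eta M X Y\<close> is linear in that vector, and \<open>C\<^sup>1\<close> if
  \<open>1 \<le> q\<close>. Stokes' theorem then turns \<open>omega2\<close> into the integral over the boundary of the
  triangle, whose edges are the cofaces, the middle one traversed backwards; this reversal is the
  sign of \<open>d\<^sub>1\<close> in the coboundary.
\<close>

section \<open>Finite-dimensional normed spaces\<close>

text \<open>\<open>omega_can\<close> and the tangent map are evaluated in a chart picked by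
  \<open>SOME\<close>, possibly a different one at every point, so nothing can be said about how
  \<open>eta\<close> varies until their values are known to agree in all charts. This invariance is
  obtained by differentiating the change of cotangent coordinates, where second derivatives of the
  transition maps of \<open>M\<close> appear; hence the section on their symmetry. The model space
  carries only a norm and a finite spanning set, so boundedness of linear functionals and
  componentwise differentiation in the dual space are derived from that spanning set. Stokes'
  theorem serves the case \<open>1 \<le> q\<close>; for \<open>q = 0\<close> the linearity of
  \<open>eta\<close> in the tangent vector suffices.\<close>

lemma dist_span_insert:
  fixes B :: "'a::real_normed_vector set"
  assumes "closed (span B)" "a \<notin> span B"
  obtains d where "d > 0" "\<And>k w. w \<in> span B \<Longrightarrow> \<bar>k\<bar> * d \<le> norm (k *\<^sub>R a + w)"
proof
  have ne: "span B \<noteq> {}" using span_zero by blast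
  show pos: "infdist a (span B) > 0"
    using assms ne by (simp add: infdist_pos_not_in_closed)
  show "\<bar>k\<bar> * infdist a (span B) \<le> norm (k *\<^sub>R a + w)" if "w \<in> span B" for k w
  proof (cases "k = 0")
    case False
    \<comment> \<open>The constant is the distance from \<open>a\<close> to the closed subspace
      \<open>span B\<close>: up to the factor \<open>k\<close>, the vector
      \<open>k *\<^sub>R a + w\<close> is the difference of \<open>a\<close> and a point of
      \<open>span B\<close>. The resulting bound on the coefficient \<open>k\<close> drives both
      inductions below.\<close>
    have "infdist a (span B) \<le> dist a ((- inverse k) *\<^sub>R w)"
      by (rule infdist_le) (use that in \<open>intro span_scale\<close>)
    then have "\<bar>k\<bar> * infdist a (span B) \<le> norm (k *\<^sub>R (a + inverse k *\<^sub>R w))"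
      by (simp add: dist_norm mult_left_mono)
    then show ?thesis using False by (simp add: scaleR_add_right)
  qed simp
qed

text \<open>Along a convergent sequence the coefficients of the new vector are Cauchy, by the
  distance bound, so they converge in the reals; subtracting their contribution leaves a convergent
  sequence in the smaller, already closed span.\<close>

lemma closed_span_finite:
  fixes B :: "'a::real_normed_vector set"
  assumes "finite B"
  shows "closed (span B)"
  using assms
proof (induction B rule: finite_induct)
  case (insert a B)
  show ?case
  proof (cases "a \<in> span B")
    case True
    then show ?thesis using insert.IH by (simp add: span_redundant)
  next
    case False
    obtain d where d: "d > 0" "\<And>k w. w \<in> span B \<Longrightarrow> \<bar>k\<bar> * d \<le> norm (k *\<^sub>R a + w)"
      using dist_span_insert[OF insert.IH False] by blast
    show ?thesis
      unfolding closed_sequential_limits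
    proof (intro allI impI, elim conjE)
      fix x l assume x: "\<forall>n. x n \<in> span (insert a B)" and lim: "x \<longlonglongrightarrow> l"
      have "\<forall>n. \<exists>k. x n - k *\<^sub>R a \<in> span B" using x by (simp add: span_breakdown_eq)
      then obtain k where k: "\<And>n. x n - k n *\<^sub>R a \<in> span B" by metis
      have diff: "\<bar>k m - k n\<bar> * d \<le> norm (x m - x n)" for m n
      proof -
        have "(x m - k m *\<^sub>R a) - (x n - k n *\<^sub>R a) \<in> span B" by (rule span_diff[OF k k])
        from d(2)[OF this, of "k m - k n"] show ?thesis by (simp add: algebra_simps)
      qed
      have "Cauchy k"
      proof (rule CauchyI)
        fix e :: real assume "e > 0"
        then obtain N where N: "\<forall>m\<ge>N. \<forall>n\<ge>N. norm (x m - x n) < e * d"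
          using CauchyD[OF LIMSEQ_imp_Cauchy[OF lim], of "e * d"] d(1) by auto
        have "norm (k m - k n) < e" if "m \<ge> N" "n \<ge> N" for m n
        proof -
          have "\<bar>k m - k n\<bar> * d < e * d" using N that diff[of m n] by (meson le_less_trans)
          then show ?thesis using d(1) by simp
        qed
        then show "\<exists>N. \<forall>m\<ge>N. \<forall>n\<ge>N. norm (k m - k n) < e" by blast
      qed
      then obtain k0 where "k \<longlonglongrightarrow> k0" using Cauchy_convergent convergent_def by blast
      with lim have "(\<lambda>n. x n - k n *\<^sub>R a) \<longlonglongrightarrow> l - k0 *\<^sub>R a" by (intro tendsto_intros)
      with insert.IH k have "l - k0 *\<^sub>R a \<in> span B" by (rule closed_sequentially)
      then show "l \<in> span (insert a B)" by (auto simp: span_breakdown_eq)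
    qed
  qed
qed simp

lemma linear_bounded_on_span:
  fixes f :: "'a::real_normed_vector \<Rightarrow> 'b::real_normed_vector"
  assumes "finite B" "linear f"
  shows "\<exists>K\<ge>0. \<forall>x\<in>span B. norm (f x) \<le> K * norm x"
  using assms(1)
proof (induction B rule: finite_induct)
  case empty
  then show ?case using linear_0[OF assms(2)] by (intro exI[of _ 0]) auto
next
  case (insert a B)
  then obtain K where K: "K \<ge> 0" "\<And>x. x \<in> span B \<Longrightarrow> norm (f x) \<le> K * norm x" by blast
  show ?case
  proof (cases "a \<in> span B")
    case True
    then show ?thesis using K by (auto simp: span_redundant)
  next
    case False
    obtain d where d: "d > 0" "\<And>k w. w \<in> span B \<Longrightarrow> \<bar>k\<bar> * d \<le> norm (k *\<^sub>R a + w)"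
      using dist_span_insert[OF closed_span_finite[OF insert.hyps(1)] False] by blast
    \<comment> \<open>Since \<open>\<bar>k\<bar> \<le> norm x / d\<close>, the first summand
      controls the part of \<open>f x\<close> coming from \<open>k *\<^sub>R a\<close>, and
      \<open>1 + norm a / d\<close> bounds the remainder \<open>x - k *\<^sub>R a\<close> relative
      to \<open>norm x\<close>.\<close>
    let ?K = "norm (f a) / d + K * (1 + norm a / d)"
    have "norm (f x) \<le> ?K * norm x" if "x \<in> span (insert a B)" for x
    proof -
      obtain k where w: "x - k *\<^sub>R a \<in> span B" using \<open>x \<in> span (insert a B)\<close> by (auto simp: span_breakdown_eq)
      have k: "\<bar>k\<bar> \<le> norm x / d"
        using d(2)[OF w, of k] d(1) by (simp add: field_simps)
      have "norm (x - k *\<^sub>R a) \<le> norm x + \<bar>k\<bar> * norm a"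
        using norm_triangle_ineq4[of x "k *\<^sub>R a"] by simp
      also have "\<dots> \<le> norm x + norm x / d * norm a"
        using k by (intro add_left_mono mult_right_mono) auto
      finally have w': "norm (x - k *\<^sub>R a) \<le> (1 + norm a / d) * norm x"
        by (simp add: algebra_simps)
      have "f x = k *\<^sub>R f a + f (x - k *\<^sub>R a)"
        using assms(2) by (simp add: linear_diff linear_scale)
      then have "norm (f x) \<le> \<bar>k\<bar> * norm (f a) + norm (f (x - k *\<^sub>R a))"
        by (metis norm_scaleR norm_triangle_ineq)
      also have "\<dots> \<le> norm x / d * norm (f a) + K * ((1 + norm a / d) * norm x)"
        using k K(2)[OF w] mult_left_mono[OF w' K(1)]
        by (intro add_mono mult_right_mono) auto
      finally show ?thesis by (simp add: algebra_simps)
    qed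
    moreover have "?K \<ge> 0" using d(1) K(1) by simp
    ultimately show ?thesis by blast
  qed
qed

lemma bounded_linear_finite_span:
  fixes f :: "'a::real_normed_vector \<Rightarrow> 'b::real_normed_vector"
  assumes "finite B" "span B = (UNIV :: 'a set)" "linear f"
  shows "bounded_linear f"
proof -
  obtain K where "\<And>x. norm (f x) \<le> K * norm x"
    using linear_bounded_on_span[OF assms(1,3)] assms(2) by auto
  with assms(3) show ?thesis
    by (intro bounded_linear_intro[of f K]) (auto simp: linear_add linear_scale mult.commute)
qed

text \<open>With a basis \<open>C\<close> and its dual basis \<open>c\<close>, every functional is
  the finite sum of its values \<open>L b\<close> times \<open>c b\<close>, so differentiating the
  values differentiates the functional. Coordinate changes of covectors can thus be differentiated
  after evaluation at a fixed vector.\<close>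

lemma has_derivative_blinfun_pointwise:
  fixes F F' :: "'d::real_normed_vector \<Rightarrow> 'a::real_normed_vector \<Rightarrow>\<^sub>L real"
  assumes B: "finite B" "span B = (UNIV :: 'a set)"
    and F: "\<And>w. ((\<lambda>x. F x w) has_derivative (\<lambda>h. F' h w)) (at x within S)"
  shows "(F has_derivative F') (at x within S)"
proof -
  obtain C where C: "C \<subseteq> B" "independent C" "B \<subseteq> span C"
    using maximal_independent_subset[of B] by blast
  have finC: "finite C" using C(1) B(1) finite_subset by blast
  have spanC: "span C = UNIV" using B(2) C(3) by (metis span_mono span_span top.extremum_uniqueI)
  define c where "c b = Blinfun (\<lambda>x. representation C x b)" for b
  have "linear (\<lambda>x. representation C x b)" for b
    using C(2) spanC by (intro linearI) (auto simp: representation_add representation_scale)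
  then have c: "c b x = representation C x b" for b x
    unfolding c_def by (simp add: bounded_linear_Blinfun_apply bounded_linear_finite_span[OF B])
  have decomp: "L = (\<Sum>b\<in>C. L b *\<^sub>R c b)" for L :: "'a \<Rightarrow>\<^sub>L real"
  proof (rule blinfun_eqI)
    fix x
    have "x = (\<Sum>b\<in>C. representation C x b *\<^sub>R b)"
      using sum_representation_eq[of C x C] C(2) spanC finC by simp
    then have "L x = (\<Sum>b\<in>C. L (representation C x b *\<^sub>R b))"
      by (metis blinfun.sum_right)
    then show "L x = (\<Sum>b\<in>C. L b *\<^sub>R c b) x"
      by (simp add: blinfun.sum_left blinfun.scaleR_left blinfun.scaleR_right c mult.commute)
  qed
  have "((\<lambda>x. \<Sum>b\<in>C. F x b *\<^sub>R c b) has_derivative (\<lambda>h. \<Sum>b\<in>C. F' h b *\<^sub>R c b)) (at x within S)"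
    by (intro has_derivative_sum has_derivative_scaleR_left F)
  then show ?thesis by (simp flip: decomp)
qed


section \<open>Symmetry of second derivatives\<close>

text \<open>The mean value theorem is applied twice: to the increment of \<open>g\<close> in
  direction \<open>h *\<^sub>R b\<close> as a function of the displacement along \<open>a\<close>,
  and then to the derivative of \<open>g\<close> in direction \<open>a\<close> as a function of the
  displacement along \<open>b\<close>.\<close>

lemma second_difference_mean_value:
  fixes g :: "'a::real_normed_vector \<Rightarrow> real"
  assumes h: "h > 0"
    and U: "\<And>s t. 0 \<le> s \<Longrightarrow> s \<le> h \<Longrightarrow> 0 \<le> t \<Longrightarrow> t \<le> h \<Longrightarrow> x + s *\<^sub>R a + t *\<^sub>R b \<in> U"
    and g: "\<And>y. y \<in> U \<Longrightarrow> (g has_derivative g' y) (at y)"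
    and ga: "\<And>y. y \<in> U \<Longrightarrow> ((\<lambda>y. g' y a) has_derivative ga y) (at y)"
  obtains s t where "0 < s" "s < h" "0 < t" "t < h"
    "g (x + h *\<^sub>R a + h *\<^sub>R b) - g (x + h *\<^sub>R a) - g (x + h *\<^sub>R b) + g x
      = h * h * ga (x + s *\<^sub>R a + t *\<^sub>R b) b"
proof -
  have d1: "((\<lambda>s. g (x + s *\<^sub>R a + t *\<^sub>R b)) has_real_derivative g' (x + s *\<^sub>R a + t *\<^sub>R b) a) (at s)"
    if "0 \<le> s" "s \<le> h" "0 \<le> t" "t \<le> h" for s t
  proof -
    note D = g[OF U[OF that]]
    have "((\<lambda>s. g (x + s *\<^sub>R a + t *\<^sub>R b)) has_derivative (\<lambda>k. g' (x + s *\<^sub>R a + t *\<^sub>R b) (k *\<^sub>R a))) (at s)"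
      by (rule has_derivative_compose[of "\<lambda>s. x + s *\<^sub>R a + t *\<^sub>R b", OF _ D]) (auto intro!: derivative_eq_intros)
    then show ?thesis
      unfolding has_field_derivative_def
      by (simp add: linear_scale[OF has_derivative_linear[OF D]] mult.commute[of _ "g' _ _"])
  qed
  have d2: "((\<lambda>t. g' (x + s *\<^sub>R a + t *\<^sub>R b) a) has_real_derivative ga (x + s *\<^sub>R a + t *\<^sub>R b) b) (at t)"
    if "0 \<le> s" "s \<le> h" "0 \<le> t" "t \<le> h" for s t
  proof -
    note D = ga[OF U[OF that]]
    have "((\<lambda>t. g' (x + s *\<^sub>R a + t *\<^sub>R b) a) has_derivative (\<lambda>k. ga (x + s *\<^sub>R a + t *\<^sub>R b) (k *\<^sub>R b))) (at t)"
      by (rule has_derivative_compose[of "\<lambda>t. x + s *\<^sub>R a + t *\<^sub>R b", OF _ D]) (auto intro!: derivative_eq_intros)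
    then show ?thesis
      unfolding has_field_derivative_def
      by (simp add: linear_scale[OF has_derivative_linear[OF D]] mult.commute[of _ "ga _ _"])
  qed
  \<comment> \<open>The summand \<open>0 *\<^sub>R b\<close> is kept so that both terms are values
    of the function differentiated in \<open>d1\<close>, at the parameters \<open>h\<close> and
    \<open>0\<close>.\<close>
  let ?\<phi> = "\<lambda>s. g (x + s *\<^sub>R a + h *\<^sub>R b) - g (x + s *\<^sub>R a + 0 *\<^sub>R b)"
  obtain s where s: "0 < s" "s < h"
    "?\<phi> h - ?\<phi> 0 = (h - 0) * (g' (x + s *\<^sub>R a + h *\<^sub>R b) a - g' (x + s *\<^sub>R a + 0 *\<^sub>R b) a)"
  proof -
    have "(?\<phi> has_real_derivative g' (x + s *\<^sub>R a + h *\<^sub>R b) a - g' (x + s *\<^sub>R a + 0 *\<^sub>R b) a) (at s)"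
      if "0 \<le> s" "s \<le> h" for s
      using that h by (intro DERIV_diff d1) auto
    from MVT2[OF h this] that show thesis by blast
  qed
  obtain t where t: "0 < t" "t < h"
    "g' (x + s *\<^sub>R a + h *\<^sub>R b) a - g' (x + s *\<^sub>R a + 0 *\<^sub>R b) a = (h - 0) * ga (x + s *\<^sub>R a + t *\<^sub>R b) b"
  proof -
    have "0 \<le> s" "s \<le> h" using s by auto
    from MVT2[OF h d2[OF this]] that show thesis by blast
  qed
  show ?thesis using that[OF s(1,2) t(1,2)] s(3) t(3) by simp
qed

text \<open>The second difference is symmetric in \<open>a\<close> and \<open>b\<close>, and it
  equals \<open>h * h\<close> times a mixed derivative taken in either order, at points near
  \<open>x\<close>; continuity of the mixed derivatives moves the comparison to \<open>x\<close>.
  The derivatives are directional, the form in which \<open>Ck_on\<close> supplies them.\<close>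

lemma symmetric_second_derivative_real:
  fixes g :: "'a::real_normed_vector \<Rightarrow> real"
  assumes U: "open U" "x \<in> U"
    and g: "\<And>y. y \<in> U \<Longrightarrow> (g has_derivative g' y) (at y)"
    and ga: "\<And>y. y \<in> U \<Longrightarrow> ((\<lambda>y. g' y a) has_derivative ga y) (at y)"
    and gb: "\<And>y. y \<in> U \<Longrightarrow> ((\<lambda>y. g' y b) has_derivative gb y) (at y)"
    and cont: "continuous_on U (\<lambda>y. ga y b)" "continuous_on U (\<lambda>y. gb y a)"
  shows "ga x b = gb x a"
proof -
  have "\<bar>ga x b - gb x a\<bar> < e" if "e > 0" for e
  proof -
    have "((\<lambda>y. ga y b) \<longlongrightarrow> ga x b) (at x)" "((\<lambda>y. gb y a) \<longlongrightarrow> gb x a) (at x)"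
      using cont U by (auto simp: continuous_on_eq_continuous_at isCont_def)
    then have "((\<lambda>y. ga y b) \<longlongrightarrow> ga x b) (nhds x)" "((\<lambda>y. gb y a) \<longlongrightarrow> gb x a) (nhds x)"
      using tendsto_at_iff_tendsto_nhds[of "\<lambda>y. ga y b" x] tendsto_at_iff_tendsto_nhds[of "\<lambda>y. gb y a" x]
      by auto
    then have "\<forall>\<^sub>F y in nhds x. dist (ga y b) (ga x b) < e / 2" "\<forall>\<^sub>F y in nhds x. dist (gb y a) (gb x a) < e / 2"
      using \<open>e > 0\<close> tendstoD[where e = "e / 2"] by auto
    moreover have "\<forall>\<^sub>F y in nhds x. y \<in> U" using U eventually_nhds by blast
    ultimately have "\<forall>\<^sub>F y in nhds x. y \<in> U \<and> dist (ga y b) (ga x b) < e / 2 \<and> dist (gb y a) (gb x a) < e / 2"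
      by eventually_elim simp
    then obtain r where r: "r > 0" "\<And>y. dist y x < r \<Longrightarrow> y \<in> U"
      "\<And>y. dist y x < r \<Longrightarrow> dist (ga y b) (ga x b) < e / 2"
      "\<And>y. dist y x < r \<Longrightarrow> dist (gb y a) (gb x a) < e / 2"
      unfolding eventually_nhds_metric by blast
    \<comment> \<open>The parallelogram with sides \<open>h *\<^sub>R a\<close> and
      \<open>h *\<^sub>R b\<close> then lies within \<open>r / 2\<close> of \<open>x\<close>; the
      \<open>1\<close> keeps the denominator positive when both directions vanish.\<close>
    define h where "h = r / (2 * (norm a + norm b + 1))"
    have h: "h > 0" unfolding h_def using r(1) by (intro divide_pos_pos) (auto simp: add_nonneg_pos)
    have dist: "dist (x + s *\<^sub>R a + t *\<^sub>R b) x < r" if "0 \<le> s" "s \<le> h" "0 \<le> t" "t \<le> h" for s t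
    proof -
      have "dist (x + s *\<^sub>R a + t *\<^sub>R b) x \<le> s * norm a + t * norm b"
        using norm_triangle_ineq[of "s *\<^sub>R a" "t *\<^sub>R b"] that by (simp add: dist_norm add.assoc)
      also have "\<dots> \<le> h * norm a + h * norm b"
        using that by (intro add_mono mult_right_mono) auto
      also have "\<dots> \<le> h * (norm a + norm b + 1)" using h by (simp add: algebra_simps)
      also have "\<dots> = r / 2"
        unfolding h_def using add_nonneg_pos[of "norm a + norm b" 1] by (simp add: field_simps)
      finally show ?thesis using r(1) by simp
    qed
    obtain s t where st: "0 < s" "s < h" "0 < t" "t < h"
      "g (x + h *\<^sub>R a + h *\<^sub>R b) - g (x + h *\<^sub>R a) - g (x + h *\<^sub>R b) + g x
        = h * h * ga (x + s *\<^sub>R a + t *\<^sub>R b) b"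
      by (rule second_difference_mean_value[OF h _ g ga, where x = x and b = b]) (use dist r(2) in auto)
    obtain t' s' where ts: "0 < t'" "t' < h" "0 < s'" "s' < h"
      "g (x + h *\<^sub>R b + h *\<^sub>R a) - g (x + h *\<^sub>R b) - g (x + h *\<^sub>R a) + g x
        = h * h * gb (x + t' *\<^sub>R b + s' *\<^sub>R a) a"
    proof (rule second_difference_mean_value[OF h _ g gb, where x = x and b = a])
      fix s t assume "0 \<le> s" "s \<le> h" "0 \<le> t" "t \<le> h"
      then show "x + s *\<^sub>R b + t *\<^sub>R a \<in> U"
        using r(2)[OF dist, of t s] by (simp add: add.assoc add.commute[of "s *\<^sub>R b"])
    qed auto
    have swap: "x + h *\<^sub>R b + h *\<^sub>R a = x + h *\<^sub>R a + h *\<^sub>R b" by simp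
    have "h * h * ga (x + s *\<^sub>R a + t *\<^sub>R b) b = h * h * gb (x + t' *\<^sub>R b + s' *\<^sub>R a) a"
      using st(5) ts(5) unfolding swap by linarith
    then have "ga (x + s *\<^sub>R a + t *\<^sub>R b) b = gb (x + t' *\<^sub>R b + s' *\<^sub>R a) a"
      using h by simp
    moreover have "x + t' *\<^sub>R b + s' *\<^sub>R a = x + s' *\<^sub>R a + t' *\<^sub>R b" by simp
    ultimately show ?thesis
      using r(3)[OF dist, of s t] r(4)[OF dist, of s' t'] st(1-4) ts(1-4)
      unfolding dist_real_def by (simp; linarith)
  qed
  note small = this
  show ?thesis
  proof (rule ccontr)
    assume "ga x b \<noteq> gb x a"
    then show False using small[of "\<bar>ga x b - gb x a\<bar>"] by simp
  qed
qed

section \<open>Charts and tangent vectors\<close>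

lemma frechet_derivative_eqI:
  "(f has_derivative f') (at x) \<Longrightarrow> frechet_derivative f (at x) h = f' h"
  by (drule frechet_derivative_at) simp

lemma has_derivative_cong_nhds:
  assumes "(f has_derivative f') (at x)" "\<forall>\<^sub>F y in nhds x. f y = g y"
  shows "(g has_derivative f') (at x)"
proof (rule has_derivative_transform_eventually[OF assms(1)])
  show "\<forall>\<^sub>F y in at x. f y = g y"
    using assms(2) by (auto simp: eventually_at_filter elim: eventually_mono)
qed (use eventually_nhds_x_imp_x[OF assms(2)] in auto)

lemma Ck_on_imp_continuous_on: "Ck_on k f S \<Longrightarrow> continuous_on S f"
  by (cases k) (auto intro: has_derivative_continuous_on)

abbreviation chart_inv :: "('a, 'e) chart \<Rightarrow> 'e \<Rightarrow> 'a" where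
  "chart_inv \<kappa> \<equiv> inv_into (fst \<kappa>) (snd \<kappa>)"

abbreviation jacobian :: "('a, 'e::real_normed_vector) chart \<Rightarrow> ('a, 'e) chart \<Rightarrow> 'a \<Rightarrow> 'e \<Rightarrow> 'e" where
  "jacobian \<kappa> \<kappa>' p \<equiv> frechet_derivative (transition \<kappa> \<kappa>') (at (snd \<kappa> p))"

lemma charts_atD: "\<kappa> \<in> charts_at A p \<Longrightarrow> \<kappa> \<in> A" "\<kappa> \<in> charts_at A p \<Longrightarrow> p \<in> fst \<kappa>"
  by (auto simp: charts_at_def)

locale atlas =
  fixes A :: "('a, 'e::real_normed_vector) chart set"
  assumes atlas: "smooth_atlas A"
begin

lemma inj_on_chart: "\<kappa> \<in> A \<Longrightarrow> inj_on (snd \<kappa>) (fst \<kappa>)"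
  using atlas by (auto simp: smooth_atlas_def)

lemma chart_inv_chart [simp]: "\<kappa> \<in> charts_at A p \<Longrightarrow> chart_inv \<kappa> (snd \<kappa> p) = p"
  using inj_on_chart by (auto simp: charts_at_def)

lemma transition_chart [simp]: "\<kappa> \<in> charts_at A p \<Longrightarrow> transition \<kappa> \<kappa>' (snd \<kappa> p) = snd \<kappa>' p"
  by (simp add: transition_def)

lemma open_overlap: "\<kappa> \<in> A \<Longrightarrow> \<kappa>' \<in> A \<Longrightarrow> open (snd \<kappa> ` (fst \<kappa> \<inter> fst \<kappa>'))"
  using atlas by (auto simp: smooth_atlas_def)

lemma Ck_on_transition:
  "\<kappa> \<in> A \<Longrightarrow> \<kappa>' \<in> A \<Longrightarrow> Ck_on k (transition \<kappa> \<kappa>') (snd \<kappa> ` (fst \<kappa> \<inter> fst \<kappa>'))"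
  using atlas by (auto simp: smooth_atlas_def)

text \<open>An inverse chart is meaningful only on the image of its chart. Writing nearby
  coordinates as those of points of the overlap justifies the later local rewritings under a
  derivative.\<close>

lemma eventually_chart_overlap:
  assumes "\<kappa> \<in> charts_at A p" "\<kappa>' \<in> charts_at A p"
  shows "\<forall>\<^sub>F y in nhds (snd \<kappa> p). \<exists>p'. y = snd \<kappa> p' \<and> \<kappa> \<in> charts_at A p' \<and> \<kappa>' \<in> charts_at A p'"
proof -
  have "open (snd \<kappa> ` (fst \<kappa> \<inter> fst \<kappa>'))" "snd \<kappa> p \<in> snd \<kappa> ` (fst \<kappa> \<inter> fst \<kappa>')"
    using assms by (auto simp: charts_at_def intro: open_overlap)
  then have "\<forall>\<^sub>F y in nhds (snd \<kappa> p). y \<in> snd \<kappa> ` (fst \<kappa> \<inter> fst \<kappa>')"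
    using eventually_nhds by blast
  then show ?thesis
    by eventually_elim (use assms in \<open>auto simp: charts_at_def\<close>)
qed

text \<open>\<open>Ck_on\<close> speaks of derivatives within the image of the overlap; this image
  is open, so they are plain derivatives.\<close>

lemma has_derivative_transition:
  assumes "\<kappa> \<in> charts_at A p" "\<kappa>' \<in> charts_at A p"
  shows "(transition \<kappa> \<kappa>' has_derivative jacobian \<kappa> \<kappa>' p) (at (snd \<kappa> p))"
proof -
  let ?U = "snd \<kappa> ` (fst \<kappa> \<inter> fst \<kappa>')"
  have A: "\<kappa> \<in> A" "\<kappa>' \<in> A" and p: "snd \<kappa> p \<in> ?U" using assms by (auto simp: charts_at_def)
  have "Ck_on (Suc 0) (transition \<kappa> \<kappa>') ?U" by (rule Ck_on_transition[OF A])
  then obtain f' where "(transition \<kappa> \<kappa>' has_derivative f') (at (snd \<kappa> p) within ?U)"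
    using p unfolding Ck_on.simps by blast
  then have "(transition \<kappa> \<kappa>' has_derivative f') (at (snd \<kappa> p))"
    by (simp only: at_within_open[OF p open_overlap[OF A]])
  then show ?thesis
    using differentiableI frechet_derivative_works by blast
qed

lemma linear_jacobian:
  "\<kappa> \<in> charts_at A p \<Longrightarrow> \<kappa>' \<in> charts_at A p \<Longrightarrow> linear (jacobian \<kappa> \<kappa>' p)"
  using has_derivative_transition has_derivative_linear by blast

lemma jacobian_cocycle:
  assumes "\<kappa> \<in> charts_at A p" "\<kappa>' \<in> charts_at A p" "\<kappa>'' \<in> charts_at A p"
  shows "jacobian \<kappa>' \<kappa>'' p (jacobian \<kappa> \<kappa>' p w) = jacobian \<kappa> \<kappa>'' p w"
proof -
  have "((\<lambda>y. transition \<kappa>' \<kappa>'' (transition \<kappa> \<kappa>' y)) has_derivative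
      (\<lambda>w. jacobian \<kappa>' \<kappa>'' p (jacobian \<kappa> \<kappa>' p w))) (at (snd \<kappa> p))"
    using has_derivative_compose[OF has_derivative_transition[OF assms(1,2)]]
      has_derivative_transition[OF assms(2,3)] assms(1) by simp
  moreover have "\<forall>\<^sub>F y in nhds (snd \<kappa> p). transition \<kappa>' \<kappa>'' (transition \<kappa> \<kappa>' y) = transition \<kappa> \<kappa>'' y"
    using eventually_chart_overlap[OF assms(1,2)] by eventually_elim auto
  ultimately have "(transition \<kappa> \<kappa>'' has_derivative (\<lambda>w. jacobian \<kappa>' \<kappa>'' p (jacobian \<kappa> \<kappa>' p w))) (at (snd \<kappa> p))"
    by (rule has_derivative_cong_nhds)
  then show ?thesis by (rule frechet_derivative_eqI[symmetric])
qed

lemma jacobian_self: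
  assumes "\<kappa> \<in> charts_at A p"
  shows "jacobian \<kappa> \<kappa> p w = w"
proof -
  have "\<forall>\<^sub>F y in nhds (snd \<kappa> p). y = transition \<kappa> \<kappa> y"
    using eventually_chart_overlap[OF assms assms] by eventually_elim auto
  then have "(transition \<kappa> \<kappa> has_derivative (\<lambda>w. w)) (at (snd \<kappa> p))"
    by (rule has_derivative_cong_nhds[OF has_derivative_ident])
  then show ?thesis by (rule frechet_derivative_eqI)
qed

section \<open>Tangent vectors and their coordinates\<close>

lemma tangent_of_eq:
  "\<kappa>' \<in> charts_at A p \<Longrightarrow> tangent_of A \<kappa> p w \<kappa>' = jacobian \<kappa> \<kappa>' p w"
  by (simp add: tangent_of_def)

lemma tangent_of_same [simp]: "\<kappa> \<in> charts_at A p \<Longrightarrow> tangent_of A \<kappa> p w \<kappa> = w"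
  by (simp add: tangent_of_eq jacobian_self)

lemma tangent_of_in_tangent_space: "\<kappa> \<in> charts_at A p \<Longrightarrow> tangent_of A \<kappa> p w \<in> tangent_space A p"
  by (auto simp: tangent_space_def tangent_of_def jacobian_cocycle)

lemma tangent_space_jacobian:
  assumes "v \<in> tangent_space A p" "\<kappa> \<in> charts_at A p" "\<kappa>' \<in> charts_at A p"
  shows "jacobian \<kappa> \<kappa>' p (v \<kappa>) = v \<kappa>'"
  by (rule sym) (use assms in \<open>unfold tangent_space_def, blast\<close>)

text \<open>Compatibility recovers the coordinates in every chart at \<open>p\<close> from those in
  one; at all other charts both sides have the default value 0, so the equality is one of
  functions.\<close>

lemma tangent_of_coords:
  assumes "v \<in> tangent_space A p" "\<kappa> \<in> charts_at A p"
  shows "tangent_of A \<kappa> p (v \<kappa>) = v"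
proof
  fix \<kappa>'
  show "tangent_of A \<kappa> p (v \<kappa>) \<kappa>' = v \<kappa>'"
  proof (cases "\<kappa>' \<in> charts_at A p")
    case True
    then show ?thesis using assms by (simp add: tangent_of_eq tangent_space_jacobian)
  next
    case False
    moreover have "v \<kappa>' = 0" using assms(1) False unfolding tangent_space_def by blast
    ultimately show ?thesis by (simp add: tangent_of_def)
  qed
qed

lemma tangent_of_add:
  "\<kappa> \<in> charts_at A p \<Longrightarrow>
    tangent_of A \<kappa> p (v + w) = (\<lambda>\<kappa>'. tangent_of A \<kappa> p v \<kappa>' + tangent_of A \<kappa> p w \<kappa>')"
  by (auto simp: tangent_of_def fun_eq_iff linear_add[OF linear_jacobian])

lemma tangent_of_scaleR:
  "\<kappa> \<in> charts_at A p \<Longrightarrow> tangent_of A \<kappa> p (r *\<^sub>R v) = (\<lambda>\<kappa>'. r *\<^sub>R tangent_of A \<kappa> p v \<kappa>')"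
  by (auto simp: tangent_of_def fun_eq_iff linear_scale[OF linear_jacobian])

text \<open>\<open>H w y v\<close> is the second derivative of the transition at \<open>y\<close>,
  in direction \<open>w\<close> first and then \<open>v\<close>. Symmetry is stated after applying a
  functional because it is proved for real functions, and a covector is what gets composed with
  \<open>H\<close> later.\<close>

lemma transition_second_derivative:
  assumes "\<kappa> \<in> A" "\<kappa>' \<in> A"
  obtains H :: "'e \<Rightarrow> 'e \<Rightarrow> 'e \<Rightarrow> 'e" where
    "\<And>p w. p \<in> fst \<kappa> \<inter> fst \<kappa>' \<Longrightarrow>
      ((\<lambda>y. frechet_derivative (transition \<kappa> \<kappa>') (at y) w) has_derivative H w (snd \<kappa> p)) (at (snd \<kappa> p))"
    "\<And>p v w (\<xi> :: 'e \<Rightarrow>\<^sub>L real). p \<in> fst \<kappa> \<inter> fst \<kappa>' \<Longrightarrow> \<xi> (H v (snd \<kappa> p) w) = \<xi> (H w (snd \<kappa> p) v)"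
proof -
  let ?U = "snd \<kappa> ` (fst \<kappa> \<inter> fst \<kappa>')" and ?\<tau> = "transition \<kappa> \<kappa>'"
  note U = open_overlap[OF assms]
  have "Ck_on (Suc (Suc 0)) ?\<tau> ?U" by (rule Ck_on_transition[OF assms])
  then obtain f' where f': "\<And>y. y \<in> ?U \<Longrightarrow> (?\<tau> has_derivative f' y) (at y within ?U)"
    and "\<forall>v. Ck_on (Suc 0) (\<lambda>y. f' y v) ?U" by auto
  then have "\<forall>v. \<exists>h. (\<forall>y\<in>?U. ((\<lambda>y. f' y v) has_derivative h y) (at y within ?U)) \<and>
      (\<forall>w. continuous_on ?U (\<lambda>y. h y w))" by simp
  then obtain H where H: "\<And>v y. y \<in> ?U \<Longrightarrow> ((\<lambda>y. f' y v) has_derivative H v y) (at y within ?U)"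
    and cont: "\<And>v w. continuous_on ?U (\<lambda>y. H v y w)" by metis
  have f'_at: "(?\<tau> has_derivative f' y) (at y)" if "y \<in> ?U" for y
    using f'[OF that] by (simp only: at_within_open[OF that U])
  have H_at: "((\<lambda>y. f' y v) has_derivative H v y) (at y)" if "y \<in> ?U" for y v
    using H[OF that] by (simp only: at_within_open[OF that U])
  show ?thesis
  proof
    fix p w assume p: "p \<in> fst \<kappa> \<inter> fst \<kappa>'"
    show "((\<lambda>y. frechet_derivative ?\<tau> (at y) w) has_derivative H w (snd \<kappa> p)) (at (snd \<kappa> p))"
      by (rule has_derivative_transform_within_open[OF H_at U])
        (use p frechet_derivative_at[OF f'_at] in \<open>auto simp: fun_eq_iff\<close>)
  next
    fix p v w and \<xi> :: "'e \<Rightarrow>\<^sub>L real" assume p: "p \<in> fst \<kappa> \<inter> fst \<kappa>'"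
    have d: "((\<lambda>y. \<xi> (?\<tau> y)) has_derivative (\<lambda>h. \<xi> (f' y h))) (at y)" if "y \<in> ?U" for y
      by (rule bounded_linear.has_derivative[OF blinfun.bounded_linear_right f'_at[OF that]])
    have dd: "((\<lambda>y. \<xi> (f' y u)) has_derivative (\<lambda>h. \<xi> (H u y h))) (at y)" if "y \<in> ?U" for y u
      by (rule bounded_linear.has_derivative[OF blinfun.bounded_linear_right H_at[OF that]])
    have c: "continuous_on ?U (\<lambda>y. \<xi> (H u y u'))" for u u'
      by (intro continuous_intros cont)
    show "\<xi> (H v (snd \<kappa> p) w) = \<xi> (H w (snd \<kappa> p) v)"
      by (rule symmetric_second_derivative_real[OF U imageI[OF p] d dd dd c c])
  qed
qed

end

section \<open>Cotangent charts\<close>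

lemma eventually_nhds_fst:
  assumes "\<forall>\<^sub>F y in nhds a. P y"
  shows "\<forall>\<^sub>F z in nhds (a, b). P (fst z)"
proof -
  have "(fst \<longlongrightarrow> a) (nhds (a, b))"
    using tendsto_fst[OF filterlim_ident[of "nhds (a, b)"]] by simp
  with assms show ?thesis by (rule eventually_compose_filterlim)
qed

locale fin_dim_atlas = atlas M for M :: "('a, 'e::real_normed_vector) chart set" +
  assumes finite_dim: "\<exists>B::'e set. finite B \<and> span B = UNIV"
begin

abbreviation cot_chart :: "('a, 'e) chart \<Rightarrow> (('a, 'e) cot, 'e \<times> ('e \<Rightarrow>\<^sub>L real)) chart" where
  "cot_chart \<equiv> cotangent_chart M"

lemma tangent_space_add:
  assumes "\<kappa> \<in> charts_at M p" "v \<in> tangent_space M p" "w \<in> tangent_space M p"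
  shows "(\<lambda>\<kappa>'. v \<kappa>' + w \<kappa>') \<in> tangent_space M p"
  using tangent_of_in_tangent_space[OF assms(1), of "v \<kappa> + w \<kappa>"]
  by (simp add: tangent_of_add tangent_of_coords assms)

lemma tangent_space_scaleR:
  assumes "\<kappa> \<in> charts_at M p" "v \<in> tangent_space M p"
  shows "(\<lambda>\<kappa>'. r *\<^sub>R v \<kappa>') \<in> tangent_space M p"
  using tangent_of_in_tangent_space[OF assms(1), of "r *\<^sub>R v \<kappa>"]
  by (simp add: tangent_of_scaleR tangent_of_coords assms)

text \<open>Makes \<open>Blinfun\<close> in the cotangent chart return the given functional; outside
  the bounded linear maps its value is unspecified.\<close>

lemma bounded_linear_covector:
  assumes "\<kappa> \<in> charts_at M p" "\<alpha> \<in> cotangent_space M p"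
  shows "bounded_linear (\<lambda>w. \<alpha> (tangent_of M \<kappa> p w))"
proof -
  have "linear (\<lambda>w. \<alpha> (tangent_of M \<kappa> p w))"
    using assms tangent_of_in_tangent_space[OF assms(1)]
    by (intro linearI) (auto simp: tangent_of_add tangent_of_scaleR cotangent_space_def)
  then show ?thesis using finite_dim bounded_linear_finite_span by blast
qed

lemma fst_cot_chart: "fst (cot_chart \<kappa>) = Sigma (fst \<kappa>) (cotangent_space M)"
  by (simp add: cotangent_chart_def)

lemma fst_cot_coords [simp]: "fst (snd (cot_chart \<kappa>) z) = snd \<kappa> (fst z)"
  by (simp add: cotangent_chart_def split_beta)

lemma snd_cot_coords:
  "\<kappa> \<in> charts_at M p \<Longrightarrow> \<alpha> \<in> cotangent_space M p \<Longrightarrow>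
    snd (snd (cot_chart \<kappa>) (p, \<alpha>)) w = \<alpha> (tangent_of M \<kappa> p w)"
  by (simp add: cotangent_chart_def bounded_linear_Blinfun_apply bounded_linear_covector)

text \<open>The inverse of the cotangent chart on the fibre over \<open>p\<close>. The value 0 off
  the tangent space follows the convention of \<open>cotangent_space\<close>, so that the inverse
  laws are equalities of functions.\<close>

definition covector_of :: "('a, 'e) chart \<Rightarrow> 'a \<Rightarrow> ('e \<Rightarrow>\<^sub>L real) \<Rightarrow> ('a, 'e) covec" where
  "covector_of \<kappa> p \<xi> = (\<lambda>v. if v \<in> tangent_space M p then \<xi> (v \<kappa>) else 0)"

lemma covector_of_tangent_of [simp]:
  "\<kappa>' \<in> charts_at M p \<Longrightarrow> covector_of \<kappa> p \<xi> (tangent_of M \<kappa>' p w) = \<xi> (tangent_of M \<kappa>' p w \<kappa>)"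
  by (simp add: covector_of_def tangent_of_in_tangent_space)

lemma covector_of_in_cotangent_space:
  "\<kappa> \<in> charts_at M p \<Longrightarrow> covector_of \<kappa> p \<xi> \<in> cotangent_space M p"
  by (auto simp: cotangent_space_def covector_of_def tangent_space_add tangent_space_scaleR
      blinfun.add_right blinfun.scaleR_right)

lemma cot_coords_covector_of:
  assumes "\<kappa> \<in> charts_at M p"
  shows "snd (cot_chart \<kappa>) (p, covector_of \<kappa> p \<xi>) = (snd \<kappa> p, \<xi>)"
  using assms
  by (intro prod_eqI blinfun_eqI) (simp_all add: snd_cot_coords covector_of_in_cotangent_space)

lemma covector_of_cot_coords:
  assumes "\<kappa> \<in> charts_at M p" "\<alpha> \<in> cotangent_space M p"
  shows "covector_of \<kappa> p (snd (snd (cot_chart \<kappa>) (p, \<alpha>))) = \<alpha>"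
proof
  fix v
  show "covector_of \<kappa> p (snd (snd (cot_chart \<kappa>) (p, \<alpha>))) v = \<alpha> v"
    using assms by (auto simp: covector_of_def snd_cot_coords tangent_of_coords cotangent_space_def)
qed

lemma inj_on_cot_chart:
  assumes "\<kappa> \<in> M"
  shows "inj_on (snd (cot_chart \<kappa>)) (fst (cot_chart \<kappa>))"
proof (rule inj_onI)
  fix z z' assume z: "z \<in> fst (cot_chart \<kappa>)" "z' \<in> fst (cot_chart \<kappa>)"
    and eq: "snd (cot_chart \<kappa>) z = snd (cot_chart \<kappa>) z'"
  obtain p \<alpha> p' \<alpha>' where [simp]: "z = (p, \<alpha>)" "z' = (p', \<alpha>')" by force
  from z have p: "\<kappa> \<in> charts_at M p" "\<kappa> \<in> charts_at M p'" "\<alpha> \<in> cotangent_space M p" "\<alpha>' \<in> cotangent_space M p'"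
    using assms by (auto simp: fst_cot_chart charts_at_def)
  have "snd \<kappa> p = snd \<kappa> p'" using arg_cong[OF eq, of fst] by simp
  then have "p = p'" using p chart_inv_chart by metis
  moreover have "\<alpha> = \<alpha>'"
    using p \<open>p = p'\<close> eq covector_of_cot_coords[of \<kappa> p \<alpha>] covector_of_cot_coords[of \<kappa> p \<alpha>'] by simp
  ultimately show "z = z'" by simp
qed

lemma cot_chart_inv:
  assumes "\<kappa> \<in> charts_at M p"
  shows "chart_inv (cot_chart \<kappa>) (snd \<kappa> p, \<xi>) = (p, covector_of \<kappa> p \<xi>)"
  using assms
  by (intro inv_into_f_eq inj_on_cot_chart cot_coords_covector_of)
    (auto simp: fst_cot_chart covector_of_in_cotangent_space dest: charts_atD)

lemma charts_at_cotangent_bundle: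
  "c \<in> charts_at (cotangent_bundle M) (p, \<alpha>) \<longleftrightarrow>
    \<alpha> \<in> cotangent_space M p \<and> (\<exists>\<kappa>\<in>charts_at M p. c = cot_chart \<kappa>)"
  unfolding charts_at_def cotangent_bundle_def by (force simp: fst_cot_chart)

section \<open>Change of coordinates between cotangent charts\<close>

lemma cot_transition:
  assumes "\<kappa> \<in> charts_at M p" "\<kappa>' \<in> charts_at M p"
  shows "transition (cot_chart \<kappa>) (cot_chart \<kappa>') (snd \<kappa> p, \<xi>) =
    snd (cot_chart \<kappa>') (p, covector_of \<kappa> p \<xi>)"
  by (simp add: transition_def cot_chart_inv assms)

lemma snd_cot_transition:
  assumes "\<kappa> \<in> charts_at M p" "\<kappa>' \<in> charts_at M p"
  shows "snd (transition (cot_chart \<kappa>) (cot_chart \<kappa>') (snd \<kappa> p, \<xi>)) w = \<xi> (jacobian \<kappa>' \<kappa> p w)"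
  by (simp add: cot_transition snd_cot_coords covector_of_in_cotangent_space assms tangent_of_eq)

text \<open>With \<sigma> the transition from \<open>\<kappa>'\<close> to \<open>\<kappa>\<close>,
  the new fibre coordinate is \<open>\<xi>\<close> composed with the derivative of \<sigma> at the
  new base point. The product rule gives one term in which the fibre coordinate varies and one in
  which the base point moves. The latter is \<open>S\<close>: the covector \<open>\<xi>\<close>
  applied to the second derivative of \<sigma>, hence symmetric.\<close>

lemma has_derivative_cot_transition:
  assumes \<kappa>: "\<kappa> \<in> charts_at M p" and \<kappa>': "\<kappa>' \<in> charts_at M p"
  obtains T' S where
    "(transition (cot_chart \<kappa>) (cot_chart \<kappa>') has_derivative T') (at (snd \<kappa> p, \<xi>))"
    "\<And>V. fst (T' V) = jacobian \<kappa> \<kappa>' p (fst V)"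
    "\<And>V w. snd (T' V) w = snd V (jacobian \<kappa>' \<kappa> p w) + S (jacobian \<kappa> \<kappa>' p (fst V)) w"
    "\<And>a b. S a b = (S b a :: real)"
proof -
  let ?T = "transition (cot_chart \<kappa>) (cot_chart \<kappa>')" and ?q = "snd \<kappa>' p" and ?J = "jacobian \<kappa> \<kappa>' p"
  let ?D = "\<lambda>y. frechet_derivative (transition \<kappa>' \<kappa>) (at y)"
  have p: "p \<in> fst \<kappa>' \<inter> fst \<kappa>" using \<kappa> \<kappa>' by (auto simp: charts_at_def)
  obtain H :: "'e \<Rightarrow> 'e \<Rightarrow> 'e \<Rightarrow> 'e" where
    H': "\<And>p w. p \<in> fst \<kappa>' \<inter> fst \<kappa> \<Longrightarrow> ((\<lambda>y. ?D y w) has_derivative H w (snd \<kappa>' p)) (at (snd \<kappa>' p))"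
    and sym': "\<And>p v w (\<zeta> :: 'e \<Rightarrow>\<^sub>L real). p \<in> fst \<kappa>' \<inter> fst \<kappa> \<Longrightarrow>
      \<zeta> (H v (snd \<kappa>' p) w) = \<zeta> (H w (snd \<kappa>' p) v)"
    by (rule transition_second_derivative[OF charts_atD(1)[OF \<kappa>'] charts_atD(1)[OF \<kappa>]]) (rule that)
  note H = H'[OF p] and sym = sym'[OF p]
  define T2 where "T2 V = Blinfun (\<lambda>w. snd V (jacobian \<kappa>' \<kappa> p w) + \<xi> (H w ?q (?J (fst V))))"
    for V :: "'e \<times> ('e \<Rightarrow>\<^sub>L real)"
  have T2: "T2 V w = snd V (jacobian \<kappa>' \<kappa> p w) + \<xi> (H w ?q (?J (fst V)))" for V w
  proof -
    \<comment> \<open>Linearity in \<open>w\<close> is visible in the last argument of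
      \<open>H\<close>, the direction of a derivative; symmetry moves \<open>w\<close>
      there.\<close>
    have "bounded_linear (\<lambda>w. snd V (jacobian \<kappa>' \<kappa> p w) + \<xi> (H (?J (fst V)) ?q w))"
      by (intro bounded_linear_add bounded_linear_compose[OF blinfun.bounded_linear_right]
          has_derivative_bounded_linear[OF has_derivative_transition[OF \<kappa>' \<kappa>]]
          has_derivative_bounded_linear[OF H])
    then have "bounded_linear (\<lambda>w. snd V (jacobian \<kappa>' \<kappa> p w) + \<xi> (H w ?q (?J (fst V))))"
      by (simp only: sym[of \<xi> "?J (fst V)"])
    then show ?thesis unfolding T2_def by (simp add: bounded_linear_Blinfun_apply)
  qed
  have ev: "\<forall>\<^sub>F z in nhds (snd \<kappa> p, \<xi>). \<exists>p'. fst z = snd \<kappa> p' \<and> \<kappa> \<in> charts_at M p' \<and> \<kappa>' \<in> charts_at M p'"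
    by (rule eventually_nhds_fst[OF eventually_chart_overlap[OF \<kappa> \<kappa>']])
  have \<tau>: "((\<lambda>z. transition \<kappa> \<kappa>' (fst z)) has_derivative (\<lambda>V. ?J (fst V))) (at (snd \<kappa> p, \<xi>))"
    by (rule has_derivative_compose[OF has_derivative_fst[OF has_derivative_ident]])
      (simp add: has_derivative_transition[OF \<kappa> \<kappa>'])
  have fst_T: "((\<lambda>z. fst (?T z)) has_derivative (\<lambda>V. ?J (fst V))) (at (snd \<kappa> p, \<xi>))"
  proof (rule has_derivative_cong_nhds[OF \<tau>])
    show "\<forall>\<^sub>F z in nhds (snd \<kappa> p, \<xi>). transition \<kappa> \<kappa>' (fst z) = fst (?T z)"
      using ev
    proof eventually_elim
      case (elim z)
      then show ?case by (cases z) (auto simp: cot_transition)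
    qed
  qed
  have "((\<lambda>z. snd (?T z) w) has_derivative (\<lambda>V. T2 V w)) (at (snd \<kappa> p, \<xi>))" for w
  proof (rule has_derivative_cong_nhds)
    have "((\<lambda>z. ?D (transition \<kappa> \<kappa>' (fst z)) w) has_derivative (\<lambda>V. H w ?q (?J (fst V)))) (at (snd \<kappa> p, \<xi>))"
      by (rule has_derivative_compose[OF \<tau>]) (simp add: \<kappa> H)
    from bounded_bilinear.FDERIV[OF bounded_bilinear_blinfun_apply
        has_derivative_snd[OF has_derivative_ident] this]
    show "((\<lambda>z. blinfun_apply (snd z) (?D (transition \<kappa> \<kappa>' (fst z)) w)) has_derivative (\<lambda>V. T2 V w)) (at (snd \<kappa> p, \<xi>))"
      by (simp add: T2 \<kappa> add.commute)
    show "\<forall>\<^sub>F z in nhds (snd \<kappa> p, \<xi>). blinfun_apply (snd z) (?D (transition \<kappa> \<kappa>' (fst z)) w) = snd (?T z) w"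
      using ev
    proof eventually_elim
      case (elim z)
      then show ?case by (cases z) (auto simp: snd_cot_transition)
    qed
  qed
  then have snd_T: "((\<lambda>z. snd (?T z)) has_derivative T2) (at (snd \<kappa> p, \<xi>))"
    using finite_dim by (elim exE conjE) (rule has_derivative_blinfun_pointwise)
  show ?thesis
  proof
    show "(?T has_derivative (\<lambda>V. (?J (fst V), T2 V))) (at (snd \<kappa> p, \<xi>))"
      using has_derivative_Pair[OF fst_T snd_T] by simp
    show "snd (?J (fst V), T2 V) w = snd V (jacobian \<kappa>' \<kappa> p w) + \<xi> (H (?J (fst V)) ?q w)" for V w
      by (simp add: T2 sym[of \<xi> w])
    show "\<xi> (H a ?q b) = \<xi> (H b ?q a)" for a b by (rule sym)
  qed simp
qed


section \<open>The canonical forms in cotangent charts\<close>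

lemma cot_jacobian:
  assumes "\<kappa> \<in> charts_at M p" "\<kappa>' \<in> charts_at M p" "\<alpha> \<in> cotangent_space M p"
  obtains S where
    "\<And>V. fst (jacobian (cot_chart \<kappa>) (cot_chart \<kappa>') (p, \<alpha>) V) = jacobian \<kappa> \<kappa>' p (fst V)"
    "\<And>V w. snd (jacobian (cot_chart \<kappa>) (cot_chart \<kappa>') (p, \<alpha>) V) w =
      snd V (jacobian \<kappa>' \<kappa> p w) + S (jacobian \<kappa> \<kappa>' p (fst V)) w"
    "\<And>a b. S a b = (S b a :: real)"
proof -
  obtain \<xi> where eq: "snd (cot_chart \<kappa>) (p, \<alpha>) = (snd \<kappa> p, \<xi>)"
    by (metis fst_conv fst_cot_coords prod.collapse)
  obtain T' S where T: "(transition (cot_chart \<kappa>) (cot_chart \<kappa>') has_derivative T') (at (snd \<kappa> p, \<xi>))"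
    "\<And>V. fst (T' V) = jacobian \<kappa> \<kappa>' p (fst V)"
    "\<And>V w. snd (T' V) w = snd V (jacobian \<kappa>' \<kappa> p w) + S (jacobian \<kappa> \<kappa>' p (fst V)) w"
    "\<And>a b. S a b = (S b a :: real)"
    by (rule has_derivative_cot_transition[OF assms(1,2), where \<xi> = \<xi>]) (rule that)
  show ?thesis
    by (rule that[of S]) (simp_all only: eq frechet_derivative_eqI[OF T(1)] T(2-4))
qed

text \<open>In coordinates the bundle projection is \<open>fst\<close> followed by a transition of
  \<open>M\<close>, so its derivative sees only base components. \<open>tangent_map\<close>
  evaluates it in an arbitrarily chosen cotangent chart; the hypothesis on \<open>V\<close> is the
  compatibility of base components that makes the choice irrelevant.\<close>

lemma T_proj_eq:
  assumes \<alpha>: "\<alpha> \<in> cotangent_space M p" and \<kappa>: "\<kappa> \<in> charts_at M p"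
    and V: "\<And>\<kappa> \<kappa>'. \<kappa> \<in> charts_at M p \<Longrightarrow> \<kappa>' \<in> charts_at M p \<Longrightarrow>
      fst (V (cot_chart \<kappa>')) = jacobian \<kappa> \<kappa>' p (fst (V (cot_chart \<kappa>)))"
  shows "T_proj M ((p, \<alpha>), V) = (p, tangent_of M \<kappa> p (fst (V (cot_chart \<kappa>))))"
proof -
  let ?c = "SOME c. c \<in> charts_at (cotangent_bundle M) (p, \<alpha>)"
  have "?c \<in> charts_at (cotangent_bundle M) (p, \<alpha>)"
    by (rule someI[of _ "cot_chart \<kappa>"]) (use \<alpha> \<kappa> in \<open>auto simp: charts_at_cotangent_bundle\<close>)
  then obtain \<kappa>0 where \<kappa>0: "\<kappa>0 \<in> charts_at M p" "?c = cot_chart \<kappa>0"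
    by (auto simp: charts_at_cotangent_bundle)
  have "frechet_derivative (snd \<kappa>' \<circ> fst \<circ> chart_inv (cot_chart \<kappa>0)) (at (snd (cot_chart \<kappa>0) (p, \<alpha>))) W
      = jacobian \<kappa>0 \<kappa>' p (fst W)" if \<kappa>': "\<kappa>' \<in> charts_at M p" for \<kappa>' W
  proof (rule frechet_derivative_eqI[OF has_derivative_cong_nhds])
    obtain \<xi> where eq: "snd (cot_chart \<kappa>0) (p, \<alpha>) = (snd \<kappa>0 p, \<xi>)"
      by (metis fst_conv fst_cot_coords prod.collapse)
    show "((\<lambda>z. transition \<kappa>0 \<kappa>' (fst z)) has_derivative (\<lambda>W. jacobian \<kappa>0 \<kappa>' p (fst W)))
        (at (snd (cot_chart \<kappa>0) (p, \<alpha>)))"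
      by (rule has_derivative_compose[OF has_derivative_fst[OF has_derivative_ident]])
        (simp add: has_derivative_transition[OF \<kappa>0(1) \<kappa>'])
    have "\<forall>\<^sub>F z in nhds (snd \<kappa>0 p, \<xi>). \<exists>p'. fst z = snd \<kappa>0 p' \<and> \<kappa>0 \<in> charts_at M p' \<and> \<kappa>' \<in> charts_at M p'"
      by (rule eventually_nhds_fst[OF eventually_chart_overlap[OF \<kappa>0(1) \<kappa>']])
    then show "\<forall>\<^sub>F z in nhds (snd (cot_chart \<kappa>0) (p, \<alpha>)).
        transition \<kappa>0 \<kappa>' (fst z) = (snd \<kappa>' \<circ> fst \<circ> chart_inv (cot_chart \<kappa>0)) z"
      unfolding eq
    proof eventually_elim
      case (elim z)
      then show ?case by (cases z) (auto simp: cot_chart_inv)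
    qed
  qed
  moreover have "jacobian \<kappa>0 \<kappa>' p (fst (V (cot_chart \<kappa>0))) = tangent_of M \<kappa> p (fst (V (cot_chart \<kappa>))) \<kappa>'"
    if "\<kappa>' \<in> charts_at M p" for \<kappa>'
    using V[OF \<kappa>0(1) that] V[OF \<kappa> that] that by (simp add: tangent_of_eq)
  ultimately have D: "frechet_derivative (snd \<kappa>' \<circ> fst \<circ> chart_inv (cot_chart \<kappa>0))
      (at (snd (cot_chart \<kappa>0) (p, \<alpha>))) (V (cot_chart \<kappa>0)) =
      tangent_of M \<kappa> p (fst (V (cot_chart \<kappa>))) \<kappa>'" if "\<kappa>' \<in> charts_at M p" for \<kappa>'
    using that by simp
  show ?thesis
    unfolding tangent_map_def Let_def case_prod_conv \<kappa>0(2) fst_conv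
    by (intro prod_eqI ext) (simp_all add: D, simp add: tangent_of_def)
qed

text \<open>The point is given by its coordinates \<open>(snd \<kappa> p, \<xi>)\<close> because
  \<open>ext_deriv\<close> differentiates this value over the chart image, with \<open>w\<close>
  held constant.\<close>

lemma lambda_can_in_chart:
  fixes \<xi> :: "'e \<Rightarrow>\<^sub>L real"
  assumes \<kappa>: "\<kappa> \<in> charts_at M p"
  defines "z \<equiv> (p, covector_of \<kappa> p \<xi>)"
  shows "lambda_can M z (tangent_of (cotangent_bundle M) (cot_chart \<kappa>) z w) = \<xi> (fst w)"
proof -
  let ?V = "tangent_of (cotangent_bundle M) (cot_chart \<kappa>) z w"
  note \<alpha> = covector_of_in_cotangent_space[OF \<kappa>, of \<xi>]
  have V: "fst (?V (cot_chart \<kappa>')) = jacobian \<kappa> \<kappa>' p (fst w)" if \<kappa>': "\<kappa>' \<in> charts_at M p" for \<kappa>'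
  proof -
    have "cot_chart \<kappa>' \<in> charts_at (cotangent_bundle M) z"
      using \<kappa>' \<alpha> by (auto simp: z_def charts_at_cotangent_bundle)
    moreover have "fst (jacobian (cot_chart \<kappa>) (cot_chart \<kappa>') z w) = jacobian \<kappa> \<kappa>' p (fst w)"
      unfolding z_def by (rule cot_jacobian[OF \<kappa> \<kappa>' \<alpha>]) 
    ultimately show ?thesis by (simp add: tangent_of_def)
  qed
  have "T_proj M (z, ?V) = (p, tangent_of M \<kappa> p (fst (?V (cot_chart \<kappa>))))"
    unfolding z_def by (rule T_proj_eq[OF \<alpha> \<kappa>]) (simp add: V[unfolded z_def] jacobian_cocycle \<kappa>)
  then show ?thesis
    by (simp add: lambda_can_def V[OF \<kappa>] jacobian_self \<kappa>) (simp add: z_def \<kappa>)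
qed

text \<open>On a field with constant coordinates \<open>w\<close> the form takes the value
  \<open>snd y\<close> applied to \<open>fst w\<close>, which is linear in \<open>y\<close>, so its
  derivative is the same pairing. The chart is obtained rather than given because
  \<open>ext_deriv\<close> selects it.\<close>

lemma ext_deriv_lambda_can:
  assumes \<alpha>: "\<alpha> \<in> cotangent_space M p" and "charts_at M p \<noteq> {}"
  obtains \<kappa> where "\<kappa> \<in> charts_at M p" "\<And>V W. ext_deriv (cotangent_bundle M) (lambda_can M) (p, \<alpha>) V W =
    snd (V (cot_chart \<kappa>)) (fst (W (cot_chart \<kappa>))) - snd (W (cot_chart \<kappa>)) (fst (V (cot_chart \<kappa>)))"
proof -
  let ?c = "SOME c. c \<in> charts_at (cotangent_bundle M) (p, \<alpha>)"
  obtain \<kappa>' where \<kappa>': "\<kappa>' \<in> charts_at M p" using assms(2) by blast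
  have "?c \<in> charts_at (cotangent_bundle M) (p, \<alpha>)"
    by (rule someI[of _ "cot_chart \<kappa>'"]) (use \<alpha> \<kappa>' in \<open>auto simp: charts_at_cotangent_bundle\<close>)
  then obtain \<kappa> where \<kappa>: "\<kappa> \<in> charts_at M p" "?c = cot_chart \<kappa>"
    by (auto simp: charts_at_cotangent_bundle)
  obtain \<xi> where eq: "snd (cot_chart \<kappa>) (p, \<alpha>) = (snd \<kappa> p, \<xi>)"
    by (metis fst_conv fst_cot_coords prod.collapse)
  define l where "l w y = (let z' = chart_inv (cot_chart \<kappa>) y in
    lambda_can M z' (tangent_of (cotangent_bundle M) (cot_chart \<kappa>) z' w))" for w y
  have l: "frechet_derivative (l w) (at (snd \<kappa> p, \<xi>)) V = snd V (fst w)" for w V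
  proof (rule frechet_derivative_eqI[OF has_derivative_cong_nhds])
    show "((\<lambda>y. blinfun_apply (snd y) (fst w)) has_derivative (\<lambda>V. blinfun_apply (snd V) (fst w))) (at (snd \<kappa> p, \<xi>))"
      by (rule bounded_linear.has_derivative[OF blinfun.bounded_linear_left
            has_derivative_snd[OF has_derivative_ident]])
    show "\<forall>\<^sub>F y in nhds (snd \<kappa> p, \<xi>). blinfun_apply (snd y) (fst w) = l w y"
      using eventually_nhds_fst[OF eventually_chart_overlap[OF \<kappa>(1) \<kappa>(1)]]
    proof eventually_elim
      case (elim y)
      then show ?case
        by (cases y) (auto simp: l_def cot_chart_inv lambda_can_in_chart)
    qed
  qed
  show ?thesis
  proof (rule that[OF \<kappa>(1)])
    fix V W
    show "ext_deriv (cotangent_bundle M) (lambda_can M) (p, \<alpha>) V W =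
      snd (V (cot_chart \<kappa>)) (fst (W (cot_chart \<kappa>))) - snd (W (cot_chart \<kappa>)) (fst (V (cot_chart \<kappa>)))"
      unfolding ext_deriv_def \<kappa>(2) eq Let_def by (simp only: l[unfolded l_def[abs_def] Let_def])
  qed
qed

text \<open>The second derivatives of the coordinate change enter symmetrically, so they cancel.\<close>

lemma omega_can_in_chart:
  assumes \<alpha>: "\<alpha> \<in> cotangent_space M p" and \<kappa>: "\<kappa> \<in> charts_at M p"
    and V: "V \<in> tangent_space (cotangent_bundle M) (p, \<alpha>)"
    and W: "W \<in> tangent_space (cotangent_bundle M) (p, \<alpha>)"
  shows "omega_can M (p, \<alpha>) V W =
    snd (W (cot_chart \<kappa>)) (fst (V (cot_chart \<kappa>))) - snd (V (cot_chart \<kappa>)) (fst (W (cot_chart \<kappa>)))"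
proof -
  obtain \<kappa>0 where \<kappa>0: "\<kappa>0 \<in> charts_at M p"
    and ext: "\<And>V W. ext_deriv (cotangent_bundle M) (lambda_can M) (p, \<alpha>) V W =
      snd (V (cot_chart \<kappa>0)) (fst (W (cot_chart \<kappa>0))) - snd (W (cot_chart \<kappa>0)) (fst (V (cot_chart \<kappa>0)))"
  proof (rule ext_deriv_lambda_can[OF \<alpha>])
    show "charts_at M p \<noteq> {}" using \<kappa> by blast
  qed (rule that)
  let ?c = "cot_chart \<kappa>0" and ?c' = "cot_chart \<kappa>"
  obtain S where S: "\<And>V. fst (jacobian ?c ?c' (p, \<alpha>) V) = jacobian \<kappa>0 \<kappa> p (fst V)"
    "\<And>V w. snd (jacobian ?c ?c' (p, \<alpha>) V) w = snd V (jacobian \<kappa> \<kappa>0 p w) + S (jacobian \<kappa>0 \<kappa> p (fst V)) w"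
    "\<And>a b. S a b = (S b a :: real)"
    by (rule cot_jacobian[OF \<kappa>0 \<kappa> \<alpha>]) (rule that)
  have c: "?c \<in> charts_at (cotangent_bundle M) (p, \<alpha>)" "?c' \<in> charts_at (cotangent_bundle M) (p, \<alpha>)"
    using \<kappa> \<kappa>0 \<alpha> by (auto simp: charts_at_cotangent_bundle)
  have eq: "V ?c' = jacobian ?c ?c' (p, \<alpha>) (V ?c)" "W ?c' = jacobian ?c ?c' (p, \<alpha>) (W ?c)"
    using V W c unfolding tangent_space_def by blast+
  \<comment> \<open>The two Jacobians are mutually inverse, so each pairing of fibre and base
    components has the same value in \<open>\<kappa>\<close> as in the selected chart, up to a term
    in \<open>S\<close>.\<close>
  have cancel: "jacobian \<kappa> \<kappa>0 p (jacobian \<kappa>0 \<kappa> p w) = w" for w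
    by (simp add: jacobian_cocycle jacobian_self \<kappa> \<kappa>0)
  show ?thesis
    unfolding omega_can_def ext eq S(1,2) cancel
    using S(3)[of "jacobian \<kappa>0 \<kappa> p (fst (V ?c))" "jacobian \<kappa>0 \<kappa> p (fst (W ?c))"] by simp
qed

end

section \<open>Stokes' theorem on the standard triangle\<close>

text \<open>For an integrable function this is substitution by a reflection of the interval.
  Reflection is an involution, so it preserves non-integrability as well, and then both sides have
  the default value 0.\<close>

lemma integral_reverse_unit:
  fixes f :: "real \<Rightarrow> real"
  shows "integral {0..1} (\<lambda>t. f (1 - t)) = integral {0..1} f"
proof -
  have rev: "((\<lambda>t. f (1 - t)) has_integral I) {0..1}" if "(f has_integral I) {0..1}" for f :: "real \<Rightarrow> real" and I
    using has_integral_affinity[of f I 0 1 "-1" 1] that by (simp add: image_affinity_atLeastAtMost_diff)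
  show ?thesis
  proof (cases "f integrable_on {0..1}")
    case True
    from integral_unique[OF rev[OF integrable_integral[OF this]]] show ?thesis .
  next
    case False
    moreover have "\<not> (\<lambda>t. f (1 - t)) integrable_on {0..1}"
      using False rev[of "\<lambda>t. f (1 - t)"] by (auto simp: integrable_on_def)
    ultimately show ?thesis by (simp add: not_integrable_integral)
  qed
qed

text \<open>Reversing the path keeps the points visited and changes the sign of the velocity;
  linearity extracts that sign. The argument is valid for forms of any regularity, so it covers
  \<open>q = 0\<close>.\<close>

lemma segment_integral_reverse:
  assumes "\<And>t. 0 \<le> t \<Longrightarrow> t \<le> 1 \<Longrightarrow> linear (\<lambda>v. \<theta> (linepath a b t, v))"
  shows "segment_integral \<theta> b a = - segment_integral \<theta> a b"
proof -
  have "segment_integral \<theta> b a = integral {0..1} (\<lambda>t. \<theta> (linepath a b (1 - t), a - b))"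
    by (simp add: segment_integral_def linepath_def add.commute)
  also have "\<dots> = integral {0..1} (\<lambda>t. \<theta> (linepath a b t, a - b))"
    by (rule integral_reverse_unit)
  also have "\<dots> = integral {0..1} (\<lambda>t. - \<theta> (linepath a b t, b - a))"
    by (rule Henstock_Kurzweil_Integration.integral_cong) (use linear_neg[OF assms, of _ "b - a"] in auto)
  finally show ?thesis by (simp add: segment_integral_def)
qed

section \<open>The standard triangle and derivatives within it\<close>

lemma simplex2_eq: "simplex2 = {(x, y). 0 \<le> x \<and> 0 \<le> y \<and> x + y \<le> 1}"
proof -
  have "{0..2::nat} = {0, 1, 2}" by auto
  then have "simplex2 = convex hull {(0, 0), (1, 0), (0, 1)}"
    by (simp add: simplex2_def vertex2_def insert_commute)
  also have "\<dots> = {(x, y). 0 \<le> x \<and> 0 \<le> y \<and> x + y \<le> 1}"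
  proof (intro set_eqI iffI)
    fix z :: "real \<times> real" assume "z \<in> {(x, y). 0 \<le> x \<and> 0 \<le> y \<and> x + y \<le> 1}"
    then obtain x y where "z = (x, y)" "0 \<le> x" "0 \<le> y" "x + y \<le> 1" by auto
    then show "z \<in> convex hull {(0, 0), (1, 0), (0, 1)}"
      unfolding convex_hull_3
      by (intro CollectI exI[of _ "1 - x - y"] exI[of _ x] exI[of _ y]) auto
  qed (auto simp: convex_hull_3)
  finally show ?thesis .
qed

lemma compact_simplex2: "compact simplex2"
  unfolding simplex2_def by (intro finite_imp_compact_convex_hull) auto

lemma convex_simplex2: "convex simplex2"
  by (simp add: simplex2_def)

text \<open>At a boundary point the set is no neighbourhood, but by convexity it contains the
  segment from \<open>x\<close> to any of its points \<open>y\<close>. A one-sided derivative along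
  that segment determines the value at \<open>y - x\<close>, and these differences span.\<close>

lemma has_derivative_within_convex_unique:
  fixes f :: "'a::real_normed_vector \<Rightarrow> 'b::real_normed_vector"
  assumes "(f has_derivative A) (at x within S)" "(f has_derivative B) (at x within S)"
    and S: "convex S" "x \<in> S" "span ((\<lambda>y. y - x) ` S) = UNIV"
  shows "A = B"
proof
  fix v
  have dir: "((\<lambda>t. f (x + t *\<^sub>R (y - x))) has_vector_derivative C (y - x)) (at 0 within {0..1})"
    if "(f has_derivative C) (at x within S)" "y \<in> S" for C y
  proof -
    have "x + t *\<^sub>R (y - x) \<in> S" if "t \<in> {0..1}" for t
      using convexD_alt[OF S(1,2) \<open>y \<in> S\<close>, of t] that by (simp add: algebra_simps)
    then have "(f has_derivative C) (at x within (\<lambda>t. x + t *\<^sub>R (y - x)) ` {0..1})"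
      using that(1) by (auto intro: has_derivative_subset)
    then have "((\<lambda>t. f (x + t *\<^sub>R (y - x))) has_derivative (\<lambda>t. C (t *\<^sub>R (y - x)))) (at 0 within {0..1})"
      by (intro has_derivative_in_compose[where f = "\<lambda>t. x + t *\<^sub>R (y - x)" and g = f])
        (auto intro!: derivative_eq_intros)
    then show ?thesis
      by (simp add: has_vector_derivative_def linear_scale[OF has_derivative_linear[OF that(1)]])
  qed
  have "at (0::real) within {0..1} \<noteq> bot" by (simp add: at_within_Icc_at_right)
  then have eq: "A (y - x) = B (y - x)" if "y \<in> S" for y
    using dir[OF assms(1) that] dir[OF assms(2) that] vector_derivative_unique_within by blast
  have "v \<in> span ((\<lambda>y. y - x) ` S)" using S(3) by simp
  then show "A v = B v"
    by (rule linear_eq_on_span[OF has_derivative_linear[OF assms(1)] has_derivative_linear[OF assms(2)], rotated])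
      (use eq in blast)
qed

lemma has_derivative_simplex2_unique:
  fixes f :: "real \<times> real \<Rightarrow> 'b::real_normed_vector"
  assumes "(f has_derivative A) (at x within simplex2)" "(f has_derivative B) (at x within simplex2)"
    and "x \<in> simplex2"
  shows "A = B"
proof (rule has_derivative_within_convex_unique[OF assms(1,2) convex_simplex2 assms(3)])
  let ?D = "(\<lambda>y. y - x) ` simplex2"
  \<comment> \<open>Write \<open>a - b\<close> as \<open>(a - x) - (b - x)\<close>; the two edges at
    the origin then yield the coordinate directions.\<close>
  have D: "a - b \<in> span ?D" if "a \<in> simplex2" "b \<in> simplex2" for a b
    using span_diff[of "a - x" ?D "b - x"] that by (simp add: span_base)
  have "v \<in> span ?D" for v
  proof -
    have "fst v *\<^sub>R ((1, 0) - (0, 0)) + snd v *\<^sub>R ((0, 1) - (0, 0)) \<in> span ?D"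
      by (intro span_add span_scale D) (auto simp: simplex2_eq)
    then show ?thesis by simp
  qed
  then show "span ?D = UNIV" by blast
qed

text \<open>Fubini's theorem is applied to \<open>g\<close> extended by 0, which is Lebesgue
  integrable because \<open>g\<close> is continuous on a compact set; the slices, intervals of
  length \<open>1 - x\<close> or \<open>1 - y\<close>, are then turned back into gauge
  integrals.\<close>

lemma integral_simplex2_iterated:
  fixes g :: "real \<times> real \<Rightarrow> real"
  assumes g: "continuous_on simplex2 g"
  shows "g integrable_on simplex2"
    and "integral simplex2 g = integral {0..1} (\<lambda>x. integral {0..1 - x} (\<lambda>y. g (x, y)))"
    and "integral simplex2 g = integral {0..1} (\<lambda>y. integral {0..1 - y} (\<lambda>x. g (x, y)))"
proof -
  let ?h = "\<lambda>z. indicator simplex2 z *\<^sub>R g z"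
  have int: "integrable lborel ?h" by (rule borel_integrable_compact[OF compact_simplex2 g])
  then have int': "integrable (lborel \<Otimes>\<^sub>M lborel) ?h" by (simp add: lborel_prod)
  have set_int: "set_integrable lborel simplex2 g" using int by (simp add: set_integrable_def)
  show "g integrable_on simplex2" by (rule set_borel_integral_eq_integral(1)[OF set_int])
  have lb: "integral simplex2 g = (LINT z|(lborel \<Otimes>\<^sub>M lborel). ?h z)"
    using set_borel_integral_eq_integral(2)[OF set_int] by (simp add: set_lebesgue_integral_def lborel_prod)
  have slice: "(LINT y|lborel. indicator {0..1 - x} y *\<^sub>R f y) = integral {0..1 - x} f"
    if "continuous_on {0..1 - x} f" for x :: real and f :: "real \<Rightarrow> real"
  proof -
    have "set_integrable lborel {0..1 - x} f"
      using borel_integrable_compact[OF compact_Icc that] by (simp add: set_integrable_def)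
    from set_borel_integral_eq_integral(2)[OF this] show ?thesis
      by (simp add: set_lebesgue_integral_def)
  qed
  have outer: "(LINT x|lborel. indicator {0..1} x *\<^sub>R G x) = integral {0..1} G"
    if "integrable lborel (\<lambda>x. indicator {0..1} x *\<^sub>R G x)" for G :: "real \<Rightarrow> real"
    using set_borel_integral_eq_integral(2)[of "{0..1}" G] that
    by (simp add: set_lebesgue_integral_def set_integrable_def)
  have inner1: "(LINT y|lborel. ?h (x, y)) = indicator {0..1} x *\<^sub>R integral {0..1 - x} (\<lambda>y. g (x, y))" for x
  proof (cases "x \<in> {0..1}")
    case True
    have "continuous_on {0..1 - x} (\<lambda>y. g (x, y))"
      using True by (intro continuous_on_compose2[OF g]) (auto intro!: continuous_intros simp: simplex2_eq)
    from slice[OF this] have "(LINT y|lborel. indicator {0..1 - x} y *\<^sub>R g (x, y)) =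
        integral {0..1 - x} (\<lambda>y. g (x, y))" .
    moreover have "?h (x, y) = indicator {0..1 - x} y *\<^sub>R g (x, y)" for y
      using True by (auto simp: simplex2_eq indicator_def)
    ultimately have "(LINT y|lborel. ?h (x, y)) = integral {0..1 - x} (\<lambda>y. g (x, y))"
      by (simp only:)
    then show ?thesis using True by simp
  next
    case False
    then have "?h (x, y) = 0" for y by (auto simp: simplex2_eq)
    then have "(LINT y|lborel. ?h (x, y)) = 0" by (simp only: Bochner_Integration.integral_zero)
    then show ?thesis using False by simp
  qed
  have inner2: "(LINT x|lborel. ?h (x, y)) = indicator {0..1} y *\<^sub>R integral {0..1 - y} (\<lambda>x. g (x, y))" for y
  proof (cases "y \<in> {0..1}")
    case True
    have "continuous_on {0..1 - y} (\<lambda>x. g (x, y))"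
      using True by (intro continuous_on_compose2[OF g]) (auto intro!: continuous_intros simp: simplex2_eq)
    from slice[OF this] have "(LINT x|lborel. indicator {0..1 - y} x *\<^sub>R g (x, y)) =
        integral {0..1 - y} (\<lambda>x. g (x, y))" .
    moreover have "?h (x, y) = indicator {0..1 - y} x *\<^sub>R g (x, y)" for x
      using True by (auto simp: simplex2_eq indicator_def)
    ultimately have "(LINT x|lborel. ?h (x, y)) = integral {0..1 - y} (\<lambda>x. g (x, y))"
      by (simp only:)
    then show ?thesis using True by simp
  next
    case False
    then have "?h (x, y) = 0" for x by (auto simp: simplex2_eq)
    then have "(LINT x|lborel. ?h (x, y)) = 0" by (simp only: Bochner_Integration.integral_zero)
    then show ?thesis using False by simp
  qed
  show "integral simplex2 g = integral {0..1} (\<lambda>x. integral {0..1 - x} (\<lambda>y. g (x, y)))"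
    using lborel_pair.integral_fst'[OF int'] lborel_pair.integrable_fst'[OF int'] outer
    unfolding lb inner1 by simp
  have eta: "(\<lambda>(x, y). ?h (x, y)) = ?h" by (rule ext) auto
  have int'': "integrable (lborel \<Otimes>\<^sub>M lborel) (\<lambda>(x, y). ?h (x, y))"
    unfolding eta by (rule int')
  show "integral simplex2 g = integral {0..1} (\<lambda>y. integral {0..1 - y} (\<lambda>x. g (x, y)))"
    using lborel_pair.integral_snd[OF int''] lborel_pair.integrable_snd[OF int''] outer
    unfolding eta lb inner2 by simp
qed

lemma has_derivative_slice:
  fixes f :: "'a::real_normed_vector \<Rightarrow> real"
  assumes f: "(f has_derivative f') (at (c + t *\<^sub>R v) within S)" and T: "\<And>s. s \<in> T \<Longrightarrow> c + s *\<^sub>R v \<in> S"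
  shows "((\<lambda>s. f (c + s *\<^sub>R v)) has_vector_derivative f' v) (at t within T)"
proof -
  have "(f has_derivative f') (at (c + t *\<^sub>R v) within (\<lambda>s. c + s *\<^sub>R v) ` T)"
    using f T by (auto intro: has_derivative_subset)
  then have "((\<lambda>s. f (c + s *\<^sub>R v)) has_derivative (\<lambda>s. f' (s *\<^sub>R v))) (at t within T)"
    by (intro has_derivative_in_compose[where f = "\<lambda>s. c + s *\<^sub>R v" and g = f])
      (auto intro!: derivative_eq_intros)
  then show ?thesis
    by (simp add: has_vector_derivative_def linear_scale[OF has_derivative_linear[OF f]])
qed

text \<open>Each partial derivative is integrated first along its own direction, where the
  fundamental theorem of calculus leaves the value on the slanted edge minus the value on a
  leg.\<close>

lemma integral_simplex2_partials:
  assumes f: "\<And>x. x \<in> simplex2 \<Longrightarrow> (f has_derivative f' x) (at x within simplex2)"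
  shows "continuous_on simplex2 (\<lambda>x. f' x (0, 1)) \<Longrightarrow>
      integral simplex2 (\<lambda>x. f' x (0, 1)) = integral {0..1} (\<lambda>x. f (x, 1 - x) - f (x, 0) :: real)"
    and "continuous_on simplex2 (\<lambda>x. f' x (1, 0)) \<Longrightarrow>
      integral simplex2 (\<lambda>x. f' x (1, 0)) = integral {0..1} (\<lambda>y. f (1 - y, y) - f (0, y))"
proof -
  have 1: "integral {0..1 - x} (\<lambda>y. f' (x, y) (0, 1)) = f (x, 1 - x) - f (x, 0)" if "x \<in> {0..1}" for x
  proof (rule integral_unique, rule fundamental_theorem_of_calculus)
    fix y assume "y \<in> {0..1 - x}"
    then show "((\<lambda>y. f (x, y)) has_vector_derivative f' (x, y) (0, 1)) (at y within {0..1 - x})"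
      using has_derivative_slice[of f "f' (x, y)" "(x, 0)" y "(0, 1)" simplex2 "{0..1 - x}"] f[of "(x, y)"] that
      by (auto simp: simplex2_eq)
  qed (use that in auto)
  have 2: "integral {0..1 - y} (\<lambda>x. f' (x, y) (1, 0)) = f (1 - y, y) - f (0, y)" if "y \<in> {0..1}" for y
  proof (rule integral_unique, rule fundamental_theorem_of_calculus)
    fix x assume "x \<in> {0..1 - y}"
    then show "((\<lambda>x. f (x, y)) has_vector_derivative f' (x, y) (1, 0)) (at x within {0..1 - y})"
      using has_derivative_slice[of f "f' (x, y)" "(0, y)" x "(1, 0)" simplex2 "{0..1 - y}"] f[of "(x, y)"] that
      by (auto simp: simplex2_eq)
  qed (use that in auto)
  show "integral simplex2 (\<lambda>x. f' x (0, 1)) = integral {0..1} (\<lambda>x. f (x, 1 - x) - f (x, 0))"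
    if "continuous_on simplex2 (\<lambda>x. f' x (0, 1))"
    unfolding integral_simplex2_iterated(2)[OF that]
    by (rule Henstock_Kurzweil_Integration.integral_cong) (rule 1)
  show "integral simplex2 (\<lambda>x. f' x (1, 0)) = integral {0..1} (\<lambda>y. f (1 - y, y) - f (0, y))"
    if "continuous_on simplex2 (\<lambda>x. f' x (1, 0))"
    unfolding integral_simplex2_iterated(3)[OF that]
    by (rule Henstock_Kurzweil_Integration.integral_cong) (rule 2)
qed

text \<open>The two partial derivatives contribute \<open>?b\<close> on the slanted edge minus
  \<open>?b\<close> on the leg \<open>x = 0\<close>, and, with the opposite sign, \<open>?a\<close>
  on the slanted edge minus \<open>?a\<close> on the leg \<open>y = 0\<close>. Regrouped by edges,
  these are the three counterclockwise edge integrals.\<close>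

lemma integral_d2_eq_boundary_integral2:
  assumes lin: "\<And>x. x \<in> simplex2 \<Longrightarrow> linear (\<lambda>v. \<theta> (x, v))"
    and deriv: "\<And>x e. x \<in> simplex2 \<Longrightarrow> ((\<lambda>y. \<theta> (y, e)) has_derivative \<theta>' e x) (at x within simplex2)"
    and cont: "\<And>e h. continuous_on simplex2 (\<lambda>x. \<theta>' e x h)"
  shows "integral_d2 \<theta> = boundary_integral2 \<theta>"
proof -
  let ?a = "\<lambda>x. \<theta> (x, (1, 0))" and ?b = "\<lambda>x. \<theta> (x, (0, 1))"
  \<comment> \<open>\<open>frechet_derivative\<close> is a choice; uniqueness on the triangle
    identifies it with the given derivative, at boundary points too.\<close>
  have fd: "frechet_derivative (\<lambda>y. \<theta> (y, e)) (at x within simplex2) = \<theta>' e x" if "x \<in> simplex2" for x e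
    using has_derivative_simplex2_unique[OF _ deriv that] deriv[OF that] that
    by (meson differentiableI frechet_derivative_works)
  have "integral_d2 \<theta> = integral simplex2 (\<lambda>x. \<theta>' (0, 1) x (1, 0) - \<theta>' (1, 0) x (0, 1))"
    unfolding integral_d2_def by (rule Henstock_Kurzweil_Integration.integral_cong) (simp add: fd)
  also have "\<dots> = integral {0..1} (\<lambda>y. ?b (1 - y, y) - ?b (0, y)) - integral {0..1} (\<lambda>x. ?a (x, 1 - x) - ?a (x, 0))"
    by (simp add: Henstock_Kurzweil_Integration.integral_diff integral_simplex2_iterated(1) cont
        integral_simplex2_partials(1)[OF deriv] integral_simplex2_partials(2)[OF deriv])
  finally have d2: "integral_d2 \<theta> =
      integral {0..1} (\<lambda>y. ?b (1 - y, y) - ?b (0, y)) - integral {0..1} (\<lambda>x. ?a (x, 1 - x) - ?a (x, 0))" .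
  have cont_\<theta>: "continuous_on simplex2 (\<lambda>x. \<theta> (x, e))" for e
    using deriv by (rule has_derivative_continuous_on)
  have int: "(\<lambda>t. \<theta> ((p t, q t), e)) integrable_on {0..1}"
    if "continuous_on {0..1} p" "continuous_on {0..1} q" "\<And>t. t \<in> {0..1} \<Longrightarrow> (p t, q t) \<in> simplex2" for p q :: "real \<Rightarrow> real" and e
    by (intro integrable_continuous_interval continuous_on_compose2[OF cont_\<theta>, where f = "\<lambda>t. (p t, q t)"])
      (use that in \<open>auto intro!: continuous_intros\<close>)
  have ints: "(\<lambda>y. ?b (1 - y, y)) integrable_on {0..1}" "(\<lambda>y. ?b (0, y)) integrable_on {0..1}"
    "(\<lambda>x. ?a (x, 1 - x)) integrable_on {0..1}" "(\<lambda>x. ?a (x, 0)) integrable_on {0..1}"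
    "(\<lambda>x. ?a (1 - x, x)) integrable_on {0..1}"
    by (rule int; force intro!: continuous_intros simp: simplex2_eq)+
  have "segment_integral \<theta> (vertex2 0) (vertex2 1) = integral {0..1} (\<lambda>x. ?a (x, 0))"
    by (simp add: segment_integral_def vertex2_def linepath_def)
  moreover have "segment_integral \<theta> (vertex2 1) (vertex2 2) =
      integral {0..1} (\<lambda>t. ?b (1 - t, t)) - integral {0..1} (\<lambda>t. ?a (t, 1 - t))"
  proof -
    \<comment> \<open>The slanted edge has velocity \<open>(-1, 1)\<close>, so linearity splits the
      integrand. The \<open>?a\<close> part is reflected afterwards, as the slices parametrise this
      edge by \<open>x\<close> and not by \<open>1 - x\<close>.\<close>
    have "\<theta> ((1 - t, t), (-1, 1)) = ?b (1 - t, t) - ?a (1 - t, t)" if "t \<in> {0..1}" for t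
      using linear_diff[OF lin[of "(1 - t, t)"], of "(0, 1)" "(1, 0)"] that by (simp add: simplex2_eq)
    then have "segment_integral \<theta> (vertex2 1) (vertex2 2) = integral {0..1} (\<lambda>t. ?b (1 - t, t) - ?a (1 - t, t))"
      unfolding segment_integral_def
      by (intro Henstock_Kurzweil_Integration.integral_cong) (simp add: vertex2_def linepath_def)
    also have "\<dots> = integral {0..1} (\<lambda>t. ?b (1 - t, t)) - integral {0..1} (\<lambda>t. ?a (1 - t, t))"
      by (rule Henstock_Kurzweil_Integration.integral_diff[OF ints(1,5)])
    finally show ?thesis using integral_reverse_unit[of "\<lambda>t. ?a (t, 1 - t)"] by simp
  qed
  moreover have "segment_integral \<theta> (vertex2 2) (vertex2 0) = - integral {0..1} (\<lambda>t. ?b (0, t))"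
  proof -
    have "segment_integral \<theta> (vertex2 2) (vertex2 0) = - segment_integral \<theta> (vertex2 0) (vertex2 2)"
      by (rule segment_integral_reverse, rule lin) (simp add: simplex2_eq vertex2_def linepath_def)
    then show ?thesis
      by (simp add: segment_integral_def vertex2_def linepath_def)
  qed
  ultimately show ?thesis
    unfolding d2 boundary_integral2_def
    by (simp add: Henstock_Kurzweil_Integration.integral_diff ints)
qed


section \<open>Faces of the triangle\<close>

lemma coface_eq_linepath:
  "coface 0 = linepath (vertex2 1) (vertex2 2)"
  "coface 1 = linepath (vertex2 0) (vertex2 2)"
  "coface 2 = linepath (vertex2 0) (vertex2 1)"
  by (auto simp: coface_def linepath_def fun_eq_iff vertex2_def)

lemma frechet_derivative_linepath: "frechet_derivative (linepath a b) (at t) s = s *\<^sub>R (b - a)"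
proof -
  have "(linepath a b has_derivative (\<lambda>s. s *\<^sub>R (b - a))) (at t)"
    unfolding linepath_def by (auto intro!: derivative_eq_intros simp: algebra_simps)
  from frechet_derivative_at[OF this] show ?thesis by metis
qed

lemma integral_face:
  assumes "coface i = linepath a b"
  shows "integral simplex1 (\<lambda>t. \<theta> (tangent_coface i (t, 1))) = segment_integral \<theta> a b"
  by (simp add: segment_integral_def tangent_coface_def assms frechet_derivative_linepath)

lemma omega1_face:
  assumes "coface i = linepath a b"
  shows "omega1 M (face i \<phi>) (face i X) (face i Y) = segment_integral (eta M X Y) a b"
proof -
  have "omega1 M (face i \<phi>) (face i X) (face i Y) =
      integral simplex1 (\<lambda>t. eta M X Y (tangent_coface i (t, 1)))"
    unfolding omega1_def
    by (rule Henstock_Kurzweil_Integration.integral_cong) (simp add: eta_def face_def)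
  then show ?thesis using integral_face[OF assms] by simp
qed

lemma simplicial_coboundary_omega1:
  assumes "\<And>x. x \<in> simplex2 \<Longrightarrow> linear (\<lambda>v. eta M X Y (x, v))"
  shows "simplicial_coboundary 1 face face (omega1 M) \<phi> X Y = boundary_integral2 (eta M X Y)"
proof -
  have "segment_integral (eta M X Y) (vertex2 2) (vertex2 0) =
      - segment_integral (eta M X Y) (vertex2 0) (vertex2 2)"
    by (rule segment_integral_reverse, rule assms) (simp add: simplex2_eq vertex2_def linepath_def)
  moreover have "{0..1 + 1::nat} = {0, 1, 2}" by auto
  ultimately show ?thesis
    by (simp add: simplicial_coboundary_def pullback_def boundary_integral2_def
        omega1_face[OF coface_eq_linepath(1)] omega1_face[OF coface_eq_linepath(2)]
        omega1_face[OF coface_eq_linepath(3)] del: One_nat_def)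
qed

section \<open>Regularity of \<open>eta\<close>\<close>

lemma points_tangent_bundle:
  "(z, V) \<in> points (tangent_bundle B) \<longleftrightarrow> z \<in> points B \<and> V \<in> tangent_space B z"
  unfolding points_def tangent_bundle_def tangent_chart_def by simp

context fin_dim_atlas
begin

text \<open>Turns the condition that a lift covers a map into the tangent bundle of \<open>M\<close>
  into a statement on coordinates: the base components of the lift depend only on the point of the
  simplex.\<close>

lemma snd_T_proj:
  assumes z: "z \<in> points (cotangent_bundle M)" and V: "V \<in> tangent_space (cotangent_bundle M) z"
    and \<kappa>: "\<kappa> \<in> charts_at M (fst z)"
  shows "snd (T_proj M (z, V)) \<kappa> = fst (V (cot_chart \<kappa>))"
proof -
  obtain p \<alpha> where [simp]: "z = (p, \<alpha>)" by force
  have \<alpha>: "\<alpha> \<in> cotangent_space M p"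
    using z by (auto simp: points_def cotangent_bundle_def fst_cot_chart)
  have "fst (V (cot_chart \<kappa>'')) = jacobian \<kappa>' \<kappa>'' p (fst (V (cot_chart \<kappa>')))"
    if "\<kappa>' \<in> charts_at M p" "\<kappa>'' \<in> charts_at M p" for \<kappa>' \<kappa>''
  proof -
    have "cot_chart \<kappa>' \<in> charts_at (cotangent_bundle M) z" "cot_chart \<kappa>'' \<in> charts_at (cotangent_bundle M) z"
      using that \<alpha> by (auto simp: charts_at_cotangent_bundle)
    then have "V (cot_chart \<kappa>'') = jacobian (cot_chart \<kappa>') (cot_chart \<kappa>'') z (V (cot_chart \<kappa>'))"
      using V unfolding tangent_space_def by blast
    moreover have "fst (jacobian (cot_chart \<kappa>') (cot_chart \<kappa>'') z W) = jacobian \<kappa>' \<kappa>'' p (fst W)" for W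
      unfolding \<open>z = (p, \<alpha>)\<close> by (rule cot_jacobian[OF that \<alpha>])
    ultimately show ?thesis by simp
  qed
  note compat = this
  have \<kappa>p: "\<kappa> \<in> charts_at M p" using \<kappa> by simp
  have "T_proj M ((p, \<alpha>), V) = (p, tangent_of M \<kappa> p (fst (V (cot_chart \<kappa>))))"
    by (rule T_proj_eq[OF \<alpha> \<kappa>p compat])
  then show ?thesis using \<kappa>p by simp
qed

section \<open>Lifts in coordinates, linearity and differentiability of the pairing\<close>

lemma tangent_liftD:
  assumes "X \<in> tangent_lifts p q M S \<phi>" "u \<in> S \<times> UNIV"
  shows "fst (X u) = \<phi> u" "\<phi> u \<in> points (cotangent_bundle M)"
    "snd (X u) \<in> tangent_space (cotangent_bundle M) (\<phi> u)"
proof -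
  show fst: "fst (X u) = \<phi> u" using assms unfolding tangent_lifts_def by blast
  have "X u \<in> points (tangent_bundle (cotangent_bundle M))"
    using assms by (auto simp: tangent_lifts_def)
  then have "(\<phi> u, snd (X u)) \<in> points (tangent_bundle (cotangent_bundle M))"
    by (simp flip: fst)
  then show "\<phi> u \<in> points (cotangent_bundle M)" "snd (X u) \<in> tangent_space (cotangent_bundle M) (\<phi> u)"
    by (auto simp: points_tangent_bundle)
qed

lemma eta_in_chart:
  assumes X: "X \<in> tangent_lifts p q M S \<phi>" and Y: "Y \<in> tangent_lifts p q M S \<phi>"
    and u: "u \<in> S \<times> UNIV" and \<kappa>: "\<kappa> \<in> charts_at M (fst (\<phi> u))"
  shows "eta M X Y u =
    snd (snd (Y u) (cot_chart \<kappa>)) (fst (snd (X u) (cot_chart \<kappa>)))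
    - snd (snd (X u) (cot_chart \<kappa>)) (fst (snd (Y u) (cot_chart \<kappa>)))"
proof -
  obtain x \<alpha> where \<phi>: "\<phi> u = (x, \<alpha>)" by force
  have "\<alpha> \<in> cotangent_space M x"
    using tangent_liftD(2)[OF X u] by (auto simp: \<phi> points_def cotangent_bundle_def fst_cot_chart)
  then show ?thesis
    using omega_can_in_chart[of \<alpha> x \<kappa>] tangent_liftD[OF X u] tangent_liftD[OF Y u] \<kappa>
    by (simp add: eta_def \<phi>)
qed

lemma chart_at_exists:
  assumes "X \<in> tangent_lifts p q M S \<phi>" "u \<in> S \<times> UNIV"
  obtains \<kappa> where "\<kappa> \<in> charts_at M (fst (\<phi> u))"
  using tangent_liftD(2)[OF assms]
  by (auto simp: points_def cotangent_bundle_def fst_cot_chart charts_at_def)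

lemma linear_eta:
  assumes \<phi>: "\<phi> \<in> bundle_maps p q M S"
    and X: "X \<in> tangent_lifts p q M S \<phi>" and Y: "Y \<in> tangent_lifts p q M S \<phi>" and x: "x \<in> S"
  shows "linear (\<lambda>v. eta M X Y (x, v))"
proof -
  have u: "(x, v) \<in> S \<times> UNIV" for v using x by simp
  obtain \<kappa> where \<kappa>0: "\<kappa> \<in> charts_at M (fst (\<phi> (x, 0)))" by (rule chart_at_exists[OF X u])
  \<comment> \<open>The base point does not depend on \<open>v\<close>, so one chart of
    \<open>M\<close> serves all tangent vectors at \<open>x\<close>.\<close>
  have "fst (\<phi> (x, v)) = fst (\<phi> (x, 0))" for v
    using \<phi> x by (auto simp: bundle_maps_def)
  then have \<kappa>: "\<kappa> \<in> charts_at M (fst (\<phi> (x, v)))" for v using \<kappa>0 by metis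
  have base: "fst (snd (Z (x, v)) (cot_chart \<kappa>)) = fst (snd (Z (x, 0)) (cot_chart \<kappa>))"
    if Z: "Z \<in> tangent_lifts p q M S \<phi>" for Z v
  proof -
    obtain g where "\<forall>x\<in>S. \<forall>v. T_proj M (Z (x, v)) = g x"
      using Z unfolding tangent_lifts_def by blast
    then have "T_proj M (Z (x, v)) = T_proj M (Z (x, 0))" using x by simp
    moreover have "snd (T_proj M (Z (x, v))) \<kappa> = fst (snd (Z (x, v)) (cot_chart \<kappa>))" for v
      using snd_T_proj[OF tangent_liftD(2,3)[OF Z u] \<kappa>] tangent_liftD(1)[OF Z u]
      by (metis prod.collapse)
    ultimately show ?thesis by metis
  qed
  have lin: "linear (\<lambda>v. snd (snd (Z (x, v)) (cot_chart \<kappa>)))" if Z: "Z \<in> tangent_lifts p q M S \<phi>" for Z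
  proof -
    have "linear (\<lambda>v. fibre_coords M \<kappa> (Z (x, v)))"
      using Z x \<kappa>0 unfolding tangent_lifts_def by blast
    then have "linear (snd \<circ> (\<lambda>v. fibre_coords M \<kappa> (Z (x, v))))"
      by (rule linear_compose) (rule linear_snd)
    then show ?thesis by (simp add: fibre_coords_def split_beta o_def)
  qed
  \<comment> \<open>In the vectors being paired \<open>v\<close> is replaced by 0; it remains only
    in the functionals, where it enters linearly.\<close>
  have eta: "eta M X Y (x, v) = snd (snd (Y (x, v)) (cot_chart \<kappa>)) (fst (snd (X (x, 0)) (cot_chart \<kappa>)))
      - snd (snd (X (x, v)) (cot_chart \<kappa>)) (fst (snd (Y (x, 0)) (cot_chart \<kappa>)))" for v
    by (simp only: eta_in_chart[OF X Y u \<kappa>] base[OF X, of v] base[OF Y, of v])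
  show ?thesis
    by (intro linearI; simp only: eta)
      (simp_all add: linear_add[OF lin[OF X]] linear_add[OF lin[OF Y]] linear_scale[OF lin[OF X]]
        linear_scale[OF lin[OF Y]] blinfun.add_left blinfun.scaleR_left algebra_simps)
qed

text \<open>\<open>Ck_map\<close> supplies a neighbourhood that the lift maps into the chart of the
  iterated bundle induced by \<open>\<kappa>\<close>. There \<open>\<kappa>\<close> remains a chart
  at the base point, and \<open>snd (X u) (cot_chart \<kappa>)\<close> is the second component of
  the coordinates of \<open>X u\<close>.\<close>

lemma tangent_lift_C1:
  assumes X: "X \<in> tangent_lifts p q M S \<phi>" and q: "1 \<le> q"
    and u: "u \<in> S \<times> UNIV" and \<kappa>: "\<kappa> \<in> charts_at M (fst (\<phi> u))"
  obtains W X' where "open W" "u \<in> W"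
    "\<And>u'. u' \<in> S \<times> UNIV \<inter> W \<Longrightarrow> \<kappa> \<in> charts_at M (fst (\<phi> u'))"
    "\<And>u'. u' \<in> S \<times> UNIV \<inter> W \<Longrightarrow>
      ((\<lambda>u. snd (X u) (cot_chart \<kappa>)) has_derivative X' u') (at u' within S \<times> UNIV \<inter> W)"
    "\<And>h. continuous_on (S \<times> UNIV \<inter> W) (\<lambda>u'. X' u' h)"
proof -
  let ?c = "tangent_chart (cotangent_bundle M) (cot_chart \<kappa>)"
  have M: "\<kappa> \<in> M" using \<kappa> by (rule charts_atD)
  have "fst (X u) \<in> fst (cot_chart \<kappa>)"
    using tangent_liftD(1,2)[OF X u] \<kappa>
    by (auto simp: points_def cotangent_bundle_def fst_cot_chart charts_at_def)
  then have "X u \<in> fst ?c"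
    using tangent_liftD[OF X u] by (cases "X u") (auto simp: tangent_chart_def)
  then have "?c \<in> charts_at (tangent_bundle (cotangent_bundle M)) (X u)"
    using M by (simp add: charts_at_def tangent_bundle_def cotangent_bundle_def)
  moreover have "Ck_map q X (S \<times> UNIV) (tangent_bundle (cotangent_bundle M))"
    using X by (simp add: tangent_lifts_def Cpq_map_def)
  ultimately obtain W where W: "open W" "u \<in> W" "X ` (S \<times> UNIV \<inter> W) \<subseteq> fst ?c"
    "Ck_on q (snd ?c \<circ> X) (S \<times> UNIV \<inter> W)"
    using u unfolding Ck_map_def by meson
  obtain k where "q = Suc k" using q by (cases q) auto
  with W(4) obtain G where G: "\<forall>u'\<in>S \<times> UNIV \<inter> W. (snd ?c \<circ> X has_derivative G u') (at u' within S \<times> UNIV \<inter> W)"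
    "\<forall>h. Ck_on k (\<lambda>u'. G u' h) (S \<times> UNIV \<inter> W)"
    by auto
  have eq: "(\<lambda>u. snd (X u) (cot_chart \<kappa>)) = (\<lambda>u. snd ((snd ?c \<circ> X) u))"
    by (simp add: tangent_chart_def split_beta)
  show ?thesis
  proof (rule that[OF W(1,2)])
    fix u' assume u': "u' \<in> S \<times> UNIV \<inter> W"
    show "((\<lambda>u. snd (X u) (cot_chart \<kappa>)) has_derivative (\<lambda>h. snd (G u' h))) (at u' within S \<times> UNIV \<inter> W)"
      unfolding eq using G(1) u' by (intro has_derivative_snd) blast
    have "X u' \<in> fst ?c" using W(3) u' by blast
    then have "fst (X u') \<in> fst (cot_chart \<kappa>)" by (cases "X u'") (auto simp: tangent_chart_def)
    then show "\<kappa> \<in> charts_at M (fst (\<phi> u'))"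
      using tangent_liftD(1)[OF X, of u'] u' M by (auto simp: fst_cot_chart charts_at_def)
  next
    fix h
    have "continuous_on (S \<times> UNIV \<inter> W) (\<lambda>u'. G u' h)" using G(2) Ck_on_imp_continuous_on by blast
    then show "continuous_on (S \<times> UNIV \<inter> W) (\<lambda>u'. snd (G u' h))" by (rule continuous_on_snd)
  qed
qed

text \<open>In a fixed chart \<open>eta\<close> is a difference of two bilinear pairings of
  coordinates of the lifts, so the product rule applies where the chart is valid for both. The
  derivative is then pulled back along the slice sending \<open>y\<close> to
  \<open>(y, e)\<close>.\<close>

lemma eta_C1:
  assumes X: "X \<in> tangent_lifts p q M S \<phi>" and Y: "Y \<in> tangent_lifts p q M S \<phi>" and q: "1 \<le> q"
    and x: "x \<in> S"
  obtains U D where "open U" "x \<in> U"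
    "\<And>y. y \<in> S \<inter> U \<Longrightarrow> ((\<lambda>y. eta M X Y (y, e)) has_derivative D y) (at y within S)"
    "\<And>h. continuous_on (S \<inter> U) (\<lambda>y. D y h)"
proof -
  have u: "(x, e) \<in> S \<times> UNIV" using x by simp
  obtain \<kappa> where \<kappa>: "\<kappa> \<in> charts_at M (fst (\<phi> (x, e)))" by (rule chart_at_exists[OF X u])
  obtain W X' where W: "open W" "(x, e) \<in> W"
    "\<And>u'. u' \<in> S \<times> UNIV \<inter> W \<Longrightarrow> \<kappa> \<in> charts_at M (fst (\<phi> u'))"
    and dX0: "\<And>u'. u' \<in> S \<times> UNIV \<inter> W \<Longrightarrow>
      ((\<lambda>u. snd (X u) (cot_chart \<kappa>)) has_derivative X' u') (at u' within S \<times> UNIV \<inter> W)"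
    and cX0: "\<And>h. continuous_on (S \<times> UNIV \<inter> W) (\<lambda>u'. X' u' h)"
    by (rule tangent_lift_C1[OF X q u \<kappa>]) (rule that)
  obtain W' Y' where W': "open W'" "(x, e) \<in> W'"
    "\<And>u'. u' \<in> S \<times> UNIV \<inter> W' \<Longrightarrow> \<kappa> \<in> charts_at M (fst (\<phi> u'))"
    and dY0: "\<And>u'. u' \<in> S \<times> UNIV \<inter> W' \<Longrightarrow>
      ((\<lambda>u. snd (Y u) (cot_chart \<kappa>)) has_derivative Y' u') (at u' within S \<times> UNIV \<inter> W')"
    and cY0: "\<And>h. continuous_on (S \<times> UNIV \<inter> W') (\<lambda>u'. Y' u' h)"
    by (rule tangent_lift_C1[OF Y q u \<kappa>]) (rule that)
  define T where "T = S \<times> UNIV \<inter> (W \<inter> W')"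
  let ?X = "\<lambda>u. snd (X u) (cot_chart \<kappa>)" and ?Y = "\<lambda>u. snd (Y u) (cot_chart \<kappa>)"
  have dX: "(?X has_derivative X' u') (at u' within T)" if "u' \<in> T" for u'
    by (rule has_derivative_subset[OF dX0]) (use that in \<open>auto simp: T_def\<close>)
  have dY: "(?Y has_derivative Y' u') (at u' within T)" if "u' \<in> T" for u'
    by (rule has_derivative_subset[OF dY0]) (use that in \<open>auto simp: T_def\<close>)
  have cX: "continuous_on T (\<lambda>u'. X' u' h)" for h
    by (rule continuous_on_subset[OF cX0]) (auto simp: T_def)
  have cY: "continuous_on T (\<lambda>u'. Y' u' h)" for h
    by (rule continuous_on_subset[OF cY0]) (auto simp: T_def)
  define D where "D u' h =
    (snd (?Y u') (fst (X' u' h)) + snd (Y' u' h) (fst (?X u')))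
    - (snd (?X u') (fst (Y' u' h)) + snd (X' u' h) (fst (?Y u')))" for u' h
  have dE: "(eta M X Y has_derivative D u') (at u' within T)" if u': "u' \<in> T" for u'
  proof (rule has_derivative_transform[OF u'])
    show "eta M X Y v = snd (?Y v) (fst (?X v)) - snd (?X v) (fst (?Y v))" if "v \<in> T" for v
      using that W(3) by (intro eta_in_chart[OF X Y]) (auto simp: T_def)
    show "((\<lambda>v. blinfun_apply (snd (?Y v)) (fst (?X v)) - blinfun_apply (snd (?X v)) (fst (?Y v)))
        has_derivative D u') (at u' within T)"
      unfolding D_def
      by (intro has_derivative_diff bounded_bilinear.FDERIV[OF bounded_bilinear_blinfun_apply]
          has_derivative_fst has_derivative_snd dX dY u')
  qed
  have cD: "continuous_on T (\<lambda>u'. D u' h)" for h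
    unfolding D_def
    by (intro continuous_intros blinfun.continuous_on cX cY
        has_derivative_continuous_on[OF dX] has_derivative_continuous_on[OF dY])
  define U where "U = (\<lambda>y. (y, e)) -` (W \<inter> W')"
  have U: "open U" unfolding U_def
    by (intro open_vimage open_Int W W') (auto intro!: continuous_intros)
  have sub: "(\<lambda>y. (y, e)) ` (S \<inter> U) \<subseteq> T" by (auto simp: U_def T_def)
  show ?thesis
  proof (rule that[OF U])
    show "x \<in> U" using W W' by (simp add: U_def)
    fix y assume y: "y \<in> S \<inter> U"
    have "((\<lambda>y. eta M X Y (y, e)) has_derivative (\<lambda>h. D (y, e) (h, 0))) (at y within S \<inter> U)"
    proof (rule has_derivative_in_compose[where f = "\<lambda>y. (y, e)" and g = "eta M X Y"])
      show "((\<lambda>y. (y, e)) has_derivative (\<lambda>h. (h, 0))) (at y within S \<inter> U)"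
        by (auto intro!: derivative_eq_intros)
      show "(eta M X Y has_derivative D (y, e)) (at (y, e) within (\<lambda>y. (y, e)) ` (S \<inter> U))"
        by (rule has_derivative_subset[OF dE sub]) (use sub y in auto)
    qed
    moreover have "at y within S \<inter> U = at y within S"
      by (rule at_within_nhd[OF _ U]) (use y in auto)
    ultimately show "((\<lambda>y. eta M X Y (y, e)) has_derivative (\<lambda>h. D (y, e) (h, 0))) (at y within S)"
      by simp
  next
    show "continuous_on (S \<inter> U) (\<lambda>y. D (y, e) (h, 0))" for h
      by (rule continuous_on_compose2[OF cD _ sub]) (auto intro!: continuous_intros)
  qed
qed

text \<open>The local derivatives of \<open>eta\<close> come from different charts. Uniqueness on
  the triangle identifies them all with one global \<open>frechet_derivative\<close>, which thereby
  inherits their continuity, as Stokes' theorem requires.\<close>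

lemma integral_d2_eta:
  assumes \<phi>: "\<phi> \<in> bundle_maps p q M simplex2"
    and X: "X \<in> tangent_lifts p q M simplex2 \<phi>" and Y: "Y \<in> tangent_lifts p q M simplex2 \<phi>"
    and q: "1 \<le> q"
  shows "integral_d2 (eta M X Y) = boundary_integral2 (eta M X Y)"
proof (rule integral_d2_eq_boundary_integral2)
  let ?D = "\<lambda>e x. frechet_derivative (\<lambda>y. eta M X Y (y, e)) (at x within simplex2)"
  show "linear (\<lambda>v. eta M X Y (x, v))" if "x \<in> simplex2" for x
    by (rule linear_eta[OF \<phi> X Y that])
  show deriv: "((\<lambda>y. eta M X Y (y, e)) has_derivative ?D e x) (at x within simplex2)"
    if x: "x \<in> simplex2" for x e
  proof (rule eta_C1[OF X Y q x, of e])
    fix U D assume "x \<in> U"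
      and "\<And>y. y \<in> simplex2 \<inter> U \<Longrightarrow> ((\<lambda>y. eta M X Y (y, e)) has_derivative D y) (at y within simplex2)"
    then have "((\<lambda>y. eta M X Y (y, e)) has_derivative D x) (at x within simplex2)" using x by blast
    from differentiableI[OF this] show ?thesis by (simp only: frechet_derivative_works)
  qed
  show "continuous_on simplex2 (\<lambda>x. ?D e x h)" for e h
    unfolding continuous_on_eq_continuous_within
  proof
    fix x assume x: "x \<in> simplex2"
    obtain U D where U: "open U" "x \<in> U"
      and D: "\<And>y. y \<in> simplex2 \<inter> U \<Longrightarrow> ((\<lambda>y. eta M X Y (y, e)) has_derivative D y) (at y within simplex2)"
      and cont: "\<And>h. continuous_on (simplex2 \<inter> U) (\<lambda>y. D y h)"
      by (rule eta_C1[OF X Y q x, of e]) (rule that)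
    have "D y = ?D e y" if "y \<in> simplex2 \<inter> U" for y
      by (rule has_derivative_simplex2_unique[OF D deriv]) (use that in auto)
    then have "continuous_on (simplex2 \<inter> U) (\<lambda>y. ?D e y h)"
      by (intro continuous_on_eq[OF cont[of h]]) (rule fun_cong)
    then have "continuous (at x within simplex2 \<inter> U) (\<lambda>y. ?D e y h)"
      using x U by (simp add: continuous_on_eq_continuous_within)
    moreover have "at x within simplex2 \<inter> U = at x within simplex2"
      by (rule at_within_nhd[OF U(2,1)]) auto
    ultimately show "continuous (at x within simplex2) (\<lambda>y. ?D e y h)" by simp
  qed
qed

end

theorem proposition3p3:
  fixes M :: "('a, 'e::banach) chart set" and p q :: nat
  assumes "smooth_manifold M" and "q \<le> p"
  shows "\<forall>\<phi> \<in> bundle_maps p q M simplex2.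
     \<forall>X \<in> tangent_lifts p q M simplex2 \<phi>. \<forall>Y \<in> tangent_lifts p q M simplex2 \<phi>.
       omega2 q M \<phi> X Y = simplicial_coboundary 1 face face (omega1 M) \<phi> X Y"
proof (intro ballI)
  fix \<phi> X Y
  assume *: "\<phi> \<in> bundle_maps p q M simplex2"
    "X \<in> tangent_lifts p q M simplex2 \<phi>" "Y \<in> tangent_lifts p q M simplex2 \<phi>"
  interpret fin_dim_atlas M
    using assms(1) by unfold_locales (auto simp: smooth_manifold_def)
  \<comment> \<open>For \<open>q = 0\<close> this is the definition of \<open>omega2\<close>; for
    \<open>1 \<le> q\<close> it is Stokes' theorem.\<close>
  have "omega2 q M \<phi> X Y = boundary_integral2 (eta M X Y)"
    using integral_d2_eta[OF *] by (simp add: omega2_def)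
  also have "\<dots> = simplicial_coboundary 1 face face (omega1 M) \<phi> X Y"
    by (rule simplicial_coboundary_omega1[symmetric]) (rule linear_eta[OF *])
  finally show "omega2 q M \<phi> X Y = simplicial_coboundary 1 face face (omega1 M) \<phi> X Y" .
qed

end
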